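(* Let $d\ge5$, let $N\cong\mathbb{Z}^d$ be a lattice with basis $e_1,\ldots,e_d$, and let $P\subset N_{\mathbb{Q}}$ be a $d$-dimensional canonical lattice simplex. Let $(s_i)_{i\ge1}$ be the Sylvester sequence. Then $$\operatorname{mult}P\le 3(s_{d-1}-1)^2,$$ with equality if and only if $$P\cong\operatorname{conv}\{0,s_1e_1,\ldots,s_{d-2}e_{d-2},3(s_{d-1}-1)e_{d-1},3(s_{d-1}-1)e_d\}-(1,\ldots,1).$$
   Context: The Sylvester sequence is defined by $s_1:=2$ and $s_i:=s_1\cdots s_{i-1}+1$ for $i\ge2$. $N_{\mathbb{Q}}:=N\otimes_{\mathbb{Z}}\mathbb{Q}$. A $d$-dimensional canonical lattice simplex is a $d$-dimensional simplex $P\subset N_{\mathbb{Q}}$ with vertices in $N$ such that the origin is the only point of $N$ in the interior of $P$. The multiplicity $\operatorname{mult}P$ is the index $[N:N']$, where $N'$ is the sublattice of $N$ generated by the vertices $v_0,\ldots,v_d$ of $P$. Here $\cong$ denotes unimodular equivalence: $Q\cong Q'$ if $Q'=AQ+w$ for some $A\in\mathrm{GL}(N)$ and $w\in N$. (For canonical lattice simplices the translation vector $w$ is necessarily $0$, because the origin is the unique interior lattice point.) *)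

theory Defs
  imports "HOL-Analysis.Analysis"
begin

text \<open>
  The lattice \<open>N\<close> lives in a real vector space \<open>N\<^sub>\<real>\<close> spanned by it, rather than in
  \<open>N\<^sub>\<rat>\<close>. A simplex with vertices in \<open>N\<close> is determined by its vertices, so it is the
  same datum over the rationals and over the reals, with the same lattice points in
  its interior; over the reals the library notions of simplex, extreme point and
  interior apply.
\<close>

fun sylvester :: "nat \<Rightarrow> nat" where
  "sylvester i = (if i \<le> 1 then 2 else (\<Prod>j = 1..i - 1. sylvester j) + 1)"

declare sylvester.simps [simp del]

definition int_span :: "'a::real_vector set \<Rightarrow> 'a set" where
  "int_span S = {\<Sum>v\<in>T. of_int (c v) *\<^sub>R v |T c. finite T \<and> T \<subseteq> S}"

definition vertices :: "'a::real_vector set \<Rightarrow> 'a set" where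
  "vertices P = {v. v extreme_point_of P}"

definition canonical_lattice_simplex :: "'a::euclidean_space set \<Rightarrow> 'a set \<Rightarrow> bool" where
  "canonical_lattice_simplex N P \<longleftrightarrow>
     int DIM('a) simplex P \<and> vertices P \<subseteq> N \<and> interior P \<inter> N = {0}"

text \<open>The number of cosets; it is \<open>0\<close> if the index is infinite, which does not happen
  for the sublattice generated by the vertices of a full-dimensional simplex.\<close>

definition subgroup_index :: "'a::ab_group_add set \<Rightarrow> 'a set \<Rightarrow> nat" where
  "subgroup_index N N' = card ((\<lambda>x. (+) x ` N') ` N)"

definition simplex_mult :: "'a::real_vector set \<Rightarrow> 'a set \<Rightarrow> nat" where
  "simplex_mult N P = subgroup_index N (int_span (vertices P))"

text \<open>An element of \<open>GL(N)\<close> is given by its linear extension \<open>A\<close> to the ambient space.\<close>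

definition unimodular_equiv :: "'a::real_vector set \<Rightarrow> 'a set \<Rightarrow> 'a set \<Rightarrow> bool" where
  "unimodular_equiv N Q Q' \<longleftrightarrow>
     (\<exists>A w. linear A \<and> bij_betw A N N \<and> w \<in> N \<and> Q' = (\<lambda>x. A x + w) ` Q)"

definition extremal_simplex :: "nat \<Rightarrow> (nat \<Rightarrow> 'a::real_vector) \<Rightarrow> 'a set" where
  "extremal_simplex d e =
     (\<lambda>x. x - (\<Sum>i = 1..d. e i)) `
       (convex hull
          ({0} \<union> {real (sylvester i) *\<^sub>R e i |i. i \<in> {1..d - 2}} \<union>
           {(3 * (real (sylvester (d - 1)) - 1)) *\<^sub>R e (d - 1),
            (3 * (real (sylvester (d - 1)) - 1)) *\<^sub>R e d}))"

end

theory Submission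
  imports Defs "HOL-Number_Theory.Cong"
begin

text \<open>
  Let \<open>\<beta>\<^sub>0 \<ge> \<dots> \<ge> \<beta>\<^sub>d\<close> be the barycentric coordinates of the origin. As the origin is
  the only interior lattice point, translates of boxes with side lengths \<open>\<beta>\<^sub>i\<close> by lattice
  points are disjoint modulo integer vectors. This packing argument gives the product-sum
  inequalities \<open>\<beta>\<^sub>0 \<cdots> \<beta>\<^sub>j \<le> \<beta>\<^sub>j\<^sub>+\<^sub>1 + \<dots> + \<beta>\<^sub>d\<close> and the bound
  \<open>mult P \<le> 1 / (\<beta>\<^sub>0 \<cdots> \<beta>\<^sub>d\<^sub>-\<^sub>2)\<close>. By a majorization argument, for \<open>d \<ge> 5\<close> the product
  \<open>\<beta>\<^sub>0 \<cdots> \<beta>\<^sub>d\<^sub>-\<^sub>2\<close> is minimal under these inequalities exactly at reciprocals of Sylvester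
  numbers followed by three equal terms. In the equality case the boxes tile space; the tiles
  next to the small edges have to be aligned with them, and by the Chinese remainder theorem
  this determines the lattice.
\<close>

section \<open>Sylvester numbers\<close>

text \<open>After scaling by a common denominator \<open>M\<close> the packing is a count in the
  finite torus \<open>(Z / M)^d\<close>, so that tiling means surjectivity of an injective map. In
  the first \<open>d\<close> coordinates modulo \<open>M\<close>, the sublattice generated by the
  vertices consists of the multiples of the single vector \<open>b = M * \<beta>\<close>, and the
  first \<open>K\<close>, which is \<open>M / b d\<close> rounded up, are distinct. Placing a box at
  each of these in every coset gives
  \<open>mult P * K * \<beta> 0 * ... * \<beta> (d - 1) <= 1\<close>. The factor
  \<open>\<beta> (d - 1)\<close> is then paid for by \<open>K * \<beta> d >= 1\<close> and the
  ordering, which is why only \<open>d - 1\<close> factors remain. The two coordinates outside the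
  product are best made equal to the smallest one inside it. These three equal terms share what the
  Sylvester reciprocals leave of the total 1, whence the constant 3. The obstacle is that the
  product-sum inequalities alone leave other candidates, with fewer Sylvester reciprocals and a
  longer equal tail; for \<open>d = 4\<close> one of them, with product \<open>1/128\<close> against
  \<open>1/108\<close>, is better.\<close>

definition sylv_prod :: "nat \<Rightarrow> nat" where
  "sylv_prod k = (\<Prod>j<k. sylvester (Suc j))"

lemma sylvester_Suc: "sylvester (Suc k) = sylv_prod k + 1"
proof (cases k)
  case 0
  then show ?thesis by (simp add: sylvester.simps[of "Suc 0"] sylv_prod_def)
next
  case (Suc m)
  have "(\<Prod>j = 1..Suc m. sylvester j) = (\<Prod>j<Suc m. sylvester (Suc j))"
    by (rule prod.reindex_bij_witness[of _ Suc "\<lambda>i. i - 1"]) auto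
  then show ?thesis using Suc by (subst sylvester.simps) (auto simp: sylv_prod_def)
qed

lemma sylv_prod_0 [simp]: "sylv_prod 0 = 1"
  by (simp add: sylv_prod_def)

lemma sylv_prod_Suc: "sylv_prod (Suc k) = sylv_prod k * (sylv_prod k + 1)"
proof -
  have "sylv_prod (Suc k) = sylv_prod k * sylvester (Suc k)" by (simp add: sylv_prod_def)
  then show ?thesis unfolding sylvester_Suc .
qed

lemma sylv_prod_pos [simp]: "sylv_prod k > 0"
  by (induction k) (auto simp: sylv_prod_Suc)

lemma sylv_prod_mono: "i \<le> j \<Longrightarrow> sylv_prod i \<le> sylv_prod j"
  by (induction j rule: dec_induct) (auto simp: sylv_prod_Suc intro: trans_le_add1)

lemma sylvester_dvd_sylv_prod: "j < k \<Longrightarrow> sylvester (Suc j) dvd sylv_prod k"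
  unfolding sylv_prod_def by (rule dvd_prodI[of _ _ "\<lambda>j. sylvester (Suc j)"]) auto

lemma coprime_sylvester:
  assumes "i \<noteq> j" shows "coprime (sylvester (Suc i)) (sylvester (Suc j))"
proof -
  have *: "coprime (sylvester (Suc i)) (sylvester (Suc j))" if "i < j" for i j
  proof -
    have "coprime (sylv_prod j) (sylv_prod j + 1)" by simp
    then show ?thesis
      using sylvester_dvd_sylv_prod[OF that] coprime_divisors dvd_refl
      unfolding sylvester_Suc[of j] by blast
  qed
  show ?thesis using *[of i j] *[of j i] assms by (metis coprime_commute linorder_neqE_nat)
qed

lemma sylv_prod_dvdI:
  fixes z :: int
  assumes "\<And>j. j < k \<Longrightarrow> int (sylvester (Suc j)) dvd z"
  shows "int (sylv_prod k) dvd z"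
  using assms
proof (induction k)
  case (Suc k)
  have "coprime (sylv_prod k) (sylv_prod k + 1)" by simp
  then have "coprime (int (sylv_prod k)) (int (sylvester (Suc k)))"
    unfolding coprime_int_iff sylvester_Suc .
  moreover have "int (sylv_prod (Suc k)) = int (sylv_prod k) * int (sylvester (Suc k))"
    by (simp add: sylv_prod_Suc sylvester_Suc distrib_left)
  ultimately show ?case using Suc by (simp add: divides_mult)
qed simp

text \<open>The deficit from 1 is the product of the terms, see
  \<open>prod_inverse_sylvester\<close>. Hence these reciprocals, continued to total 1, turn the
  product-sum inequalities into equalities, which makes them the natural extremal values.\<close>

lemma sum_inverse_sylvester:
  "(\<Sum>j<k. 1 / real (sylvester (Suc j))) = 1 - 1 / real (sylv_prod k)"
proof (induction k)
  case (Suc k)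
  have "1 / (U + 1) = 1 / U - 1 / (U * (U + 1))" if "U > 0" for U :: real
    using that by (simp add: divide_simps)
  from this[of "real (sylv_prod k)"]
  have "1 / real (sylvester (Suc k)) = 1 / real (sylv_prod k) - 1 / real (sylv_prod (Suc k))"
    by (simp add: sylvester_Suc sylv_prod_Suc distrib_left add.commute)
  with Suc show ?case by simp
qed simp

lemma prod_inverse_sylvester:
  "(\<Prod>j<k. 1 / real (sylvester (Suc j))) = 1 / real (sylv_prod k)"
  by (simp add: sylv_prod_def prod_dividef)

text \<open>Orthogonal idempotents: residues weighted by \<open>c\<close> combine into one integer
  having all of them. They serve both to reduce lattice points and to count cosets.\<close>

lemma sylvester_crt:
  obtains c :: "nat \<Rightarrow> int"
  where "\<And>i j. i < k \<Longrightarrow> j < k \<Longrightarrow> [c i = (if i = j then 1 else 0)] (mod int (sylvester (Suc j)))"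
proof -
  have "\<exists>x. \<forall>j\<in>{..<k}. [x = (if i = j then 1 else 0)] (mod sylvester (Suc j))" for i
    by (rule chinese_remainder_nat) (auto intro: coprime_sylvester)
  then obtain x where x: "\<And>i. \<forall>j\<in>{..<k}. [x i = (if i = j then 1 else 0)] (mod sylvester (Suc j))"
    by metis
  have "[int (x i) = (if i = j then 1 else 0)] (mod int (sylvester (Suc j)))" if "j < k" for i j
    using x[of i] that by (auto simp flip: cong_int_iff split: if_splits)
  then show ?thesis by (intro that[of "\<lambda>i. int (x i)"])
qed

text \<open>Summation by parts applied to the tangent inequality \<open>ln (x / a) \<ge> 1 - a / x\<close>.\<close>

lemma prod_mono_partial_sums:
  fixes x a :: "nat \<Rightarrow> real"
  assumes x: "\<And>i. i < m \<Longrightarrow> x i > 0" and a: "\<And>i. i < m \<Longrightarrow> a i > 0"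
    and anti: "\<And>i. Suc i < m \<Longrightarrow> x (Suc i) \<le> x i"
    and part: "\<And>j. j < m \<Longrightarrow> sum x {..<j} \<le> sum a {..<j}"
    and total: "sum a {..<m} \<le> sum x {..<m}"
  shows "prod a {..<m} \<le> prod x {..<m}"
    and "prod x {..<m} \<le> prod a {..<m} \<Longrightarrow> i < m \<Longrightarrow> x i = a i"
proof -
  \<comment> \<open>Summation by parts in inductive form: the partial sums of \<open>x - a\<close>
    are nonpositive, so replacing the divisor \<open>x k\<close> by the smaller
    \<open>x (Suc k)\<close> can only lower the quotient.\<close>
  have abel: "(\<Sum>i<Suc k. (x i - a i) / x i) \<ge> (\<Sum>i<Suc k. x i - a i) / x k" if "Suc k \<le> m" for k
    using that
  proof (induction k)
    case (Suc k)
    have "(\<Sum>i<Suc k. x i - a i) \<le> 0"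
      using part[of "Suc k"] Suc.prems by (simp add: sum_subtractf)
    then have "(\<Sum>i<Suc k. x i - a i) / x (Suc k) \<le> (\<Sum>i<Suc k. x i - a i) / x k"
      using anti[of k] x[of k] x[of "Suc k"] Suc.prems
      by (intro divide_left_mono_neg) auto
    then show ?case using Suc.IH Suc.prems
      by (simp add: add_divide_distrib)
  qed simp
  have nonneg: "(\<Sum>i<m. (x i - a i) / x i) \<ge> 0"
  proof (cases m)
    case (Suc k)
    have "(\<Sum>i<Suc k. x i - a i) / x k \<ge> 0"
      using total x[of k] Suc by (simp add: sum_subtractf)
    with abel[of k] Suc show ?thesis by simp
  qed simp
  have tangent: "ln (a i / x i) \<le> a i / x i - 1" if "i < m" for i
    using x[OF that] a[OF that] by (intro ln_le_minus_one) simp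
  have nz: "x i \<noteq> 0" "a i \<noteq> 0" if "i < m" for i
    using x[OF that] a[OF that] by auto
  have split: "(\<Sum>i<m. a i / x i - 1) = - (\<Sum>i<m. (x i - a i) / x i)"
    unfolding sum_negf[symmetric] using x
    by (intro sum.cong) (auto simp: diff_divide_distrib nz)
  have ln_ratio: "(\<Sum>i<m. ln (a i / x i)) = ln (prod a {..<m} / prod x {..<m})"
    using x a unfolding prod_dividef[symmetric]
    by (subst ln_prod) (auto simp: nz)
  have pos: "prod a {..<m} > 0" "prod x {..<m} > 0"
    using x a by (auto intro!: prod_pos)
  have "ln (prod a {..<m} / prod x {..<m}) \<le> 0"
  proof -
    have "(\<Sum>i<m. ln (a i / x i)) \<le> (\<Sum>i<m. a i / x i - 1)"
      by (intro sum_mono tangent) simp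
    with nonneg split ln_ratio show ?thesis by linarith
  qed
  then have "prod a {..<m} / prod x {..<m} \<le> 1"
    using pos by (subst (asm) ln_le_zero_iff) (rule divide_pos_pos)
  then show "prod a {..<m} \<le> prod x {..<m}"
    using pos by (simp add: pos_divide_le_eq del: prod_dividef)
  \<comment> \<open>If the products agree, the gaps between logarithm and tangent sum to 0, so each
    vanishes; the tangent touches only at ratio 1.\<close>
  assume "prod x {..<m} \<le> prod a {..<m}" and i: "i < m"
  then have "0 \<le> ln (prod a {..<m} / prod x {..<m})"
    using pos by (intro ln_ge_zero) (simp add: pos_le_divide_eq)
  then have "(\<Sum>i<m. (a i / x i - 1) - ln (a i / x i)) \<le> 0"
    unfolding sum_subtractf[of "\<lambda>i. a i / x i - 1"] using nonneg split ln_ratio by linarith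
  moreover have nn: "(a i / x i - 1) - ln (a i / x i) \<ge> 0" if "i < m" for i
    using tangent[OF that] by linarith
  then have "(\<Sum>i<m. (a i / x i - 1) - ln (a i / x i)) \<ge> 0"
    by (intro sum_nonneg) auto
  ultimately have "(\<Sum>i<m. (a i / x i - 1) - ln (a i / x i)) = 0" by linarith
  then have "(a i / x i - 1) - ln (a i / x i) = 0"
    using nn i sum_nonneg_eq_0_iff[of "{..<m}" "\<lambda>i. (a i / x i - 1) - ln (a i / x i)"] by auto
  then have "ln (a i / x i) = a i / x i - 1" by linarith
  then have "a i / x i = 1"
    using x[OF i] a[OF i] by (intro ln_eq_minus_one) auto
  then show "x i = a i" using x[OF i] by simp
qed

text \<open>With \<open>U = sylv_prod k\<close> and an equal tail of \<open>t = d + 1 - k\<close>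
  terms, this says that one more Sylvester reciprocal lowers the product. The three cases are those
  that occur for \<open>d >= 5\<close>; for \<open>U = 2\<close> and \<open>t = 4\<close>, which
  belongs to \<open>d = 4\<close>, the inequality would read \<open>32 < 27\<close>.\<close>

lemma power_step_bound:
  fixes U t :: nat
  assumes "4 \<le> t" and "U = 1 \<and> 6 \<le> t \<or> U = 2 \<and> 5 \<le> t \<or> 6 \<le> U"
  shows "real U * real t ^ (t - 2) < (real t - 1) ^ (t - 3) * (real U + 1) ^ (t - 2)"
proof -
  \<comment> \<open>From \<open>n >= 4\<close> to \<open>n + 1\<close> the left side grows by a
    factor of at most \<open>5/4 <= r\<close>, so the starting value decides.\<close>
  have base: "real n \<le> C * r ^ (n - 3)" 
    if "m \<le> n" "4 \<le> m" "real m \<le> C * r ^ (m - 3)" "r \<ge> 5/4" for m n C r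
    using that(1)
  proof (induction n rule: dec_induct)
    case (step n)
    have "real (Suc n) \<le> real n * r"
    proof -
      have "real n * (5/4) \<le> real n * r" using that(4) by (intro mult_left_mono) auto
      moreover have "real n \<ge> 4" using step(1) that(2) by linarith
      ultimately show ?thesis unfolding of_nat_Suc by linarith
    qed
    also have "\<dots> \<le> C * r ^ (n - 3) * r"
      using step(3) that(4) by (intro mult_right_mono) auto
    also have "\<dots> = C * r ^ (Suc n - 3)"
    proof -
      have "Suc n - 3 = Suc (n - 3)" using step(1) that(2) by linarith
      then show ?thesis by simp
    qed
    finally show ?case .
  qed (fact that(3))
  \<comment> \<open>Dividing the goal by \<open>t ^ (t - 3)\<close> leaves \<open>key\<close>. The
    lower bounds \<open>5/3\<close>, \<open>12/5\<close> and \<open>21/4\<close> on \<open>w\<close>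
    below are its values at the smallest \<open>U\<close> and \<open>t\<close> of each case.\<close>
  define w where "w = (real U + 1) * (real t - 1) / real t"
  have t: "real t \<ge> 4" using assms by simp
  have key: "real U * real t < w ^ (t - 3) * (real U + 1)"
  proof -
    consider (a) "U = 1" "6 \<le> t" | (b) "U = 2" "5 \<le> t" | (c) "6 \<le> U" "4 \<le> t"
      using assms by auto
    then show ?thesis
    proof cases
      case a
      have "w \<ge> 5/3" unfolding w_def using a by (simp add: field_simps)
      \<comment> \<open>Since \<open>(5/3) ^ 3 < 6\<close>, a factor 1 is too small at
        \<open>t = 6\<close>; \<open>13/10\<close> just suffices and stays below the available
        factor 2.\<close>
      have "real t \<le> 13/10 * (5/3) ^ (t - 3)"
        by (rule base[OF a(2)]) (auto simp: power3_eq_cube)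
      also have "\<dots> \<le> 13/10 * w ^ (t - 3)"
        using \<open>w \<ge> 5/3\<close> by (intro mult_left_mono power_mono) auto
      also have "\<dots> < 2 * w ^ (t - 3)"
        using \<open>w \<ge> 5/3\<close> by (intro mult_strict_right_mono) auto
      finally show ?thesis using a by simp
    next
      case b
      have "w \<ge> 12/5" unfolding w_def using b by (simp add: field_simps)
      have "real t \<le> 1 * (12/5) ^ (t - 3)"
        by (rule base[OF b(2)]) (auto simp: power2_eq_square)
      also have "\<dots> \<le> 1 * w ^ (t - 3)"
        using \<open>w \<ge> 12/5\<close> by (intro mult_left_mono power_mono) auto
      finally have "2 * real t \<le> 2 * w ^ (t - 3)" by simp
      also have "\<dots> < 3 * w ^ (t - 3)"
        using \<open>w \<ge> 12/5\<close> by simp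
      finally show ?thesis using b by (simp add: mult.commute)
    next
      case c
      have "7 * (3/4) \<le> (real U + 1) * ((real t - 1) / real t)"
      proof (rule mult_mono)
        show "3/4 \<le> (real t - 1) / real t" using t by (simp add: field_simps)
      qed (use c in auto)
      then have w: "w \<ge> 21/4" unfolding w_def by simp
      have "real t \<le> 1 * (21/4) ^ (t - 3)"
        by (rule base[OF c(2)]) auto
      also have "\<dots> \<le> w ^ (t - 3)"
        using w by (simp add: power_mono)
      finally have "real U * real t \<le> real U * w ^ (t - 3)" by (intro mult_left_mono) auto
      also have "\<dots> < (real U + 1) * w ^ (t - 3)"
        using w by (intro mult_strict_right_mono) auto
      finally show ?thesis by (simp add: mult.commute)
    qed
  qed
  have e: "t - 2 = Suc (t - 3)" using assms by simp
  have "real U * real t ^ (t - 2) = (real U * real t) * real t ^ (t - 3)"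
    unfolding e by simp
  also have "\<dots> < (w ^ (t - 3) * (real U + 1)) * real t ^ (t - 3)"
    using key t by (intro mult_strict_right_mono) auto
  also have "\<dots> = (w * real t) ^ (t - 3) * (real U + 1)"
    by (simp add: power_mult_distrib)
  also have "w * real t = (real U + 1) * (real t - 1)"
    using t by (simp add: w_def)
  also have "((real U + 1) * (real t - 1)) ^ (t - 3) * (real U + 1) =
     (real t - 1) ^ (t - 3) * (real U + 1) ^ (t - 2)"
    unfolding e by (simp add: power_mult_distrib)
  finally show ?thesis .
qed

section \<open>Minimizing the product under product-sum inequalities\<close>

locale product_sum =
  fixes x :: "nat \<Rightarrow> real" and d :: nat
  assumes pos: "i \<le> d \<Longrightarrow> 0 < x i"
    and anti: "i < d \<Longrightarrow> x (Suc i) \<le> x i"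
    and total: "sum x {..d} = 1"
    and prod_le_sum: "0 < j \<Longrightarrow> j \<le> d \<Longrightarrow> prod x {..<j} \<le> sum x {j..d}"
begin

lemma anti_mono: "i \<le> j \<Longrightarrow> j \<le> d \<Longrightarrow> x j \<le> x i"
proof (induction j rule: dec_induct)
  case (step n)
  then show ?case using anti[of n] by simp
qed simp

lemma sum_tail: "j \<le> d \<Longrightarrow> sum x {..<j} + sum x {j..d} = 1"
  using sum.union_disjoint[of "{..<j}" "{j..d}" x] total
  by (simp add: ivl_disj_un ivl_disj_int)

text \<open>If the bound first fails at \<open>j\<close>, majorization makes the product of the
  first \<open>j\<close> terms at least \<open>1 / sylv_prod j\<close>; by the product-sum
  inequality the remaining terms then exceed what the total 1 leaves.\<close>

lemma partial_sum_le: "j \<le> d \<Longrightarrow> sum x {..<j} \<le> 1 - 1 / real (sylv_prod j)"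
proof (induction j rule: less_induct)
  case (less j)
  show ?case
  proof (rule ccontr)
    assume neg: "\<not> ?thesis"
    then have "j > 0" by (cases j) auto
    have "(\<Prod>i<j. 1 / real (sylvester (Suc i))) \<le> prod x {..<j}"
    proof (rule prod_mono_partial_sums)
      fix k assume "k < j"
      with less show "sum x {..<k} \<le> (\<Sum>i<k. 1 / real (sylvester (Suc i)))"
        by (simp add: sum_inverse_sylvester)
    next
      show "(\<Sum>i<j. 1 / real (sylvester (Suc i))) \<le> sum x {..<j}"
        using neg unfolding sum_inverse_sylvester by simp
    qed (use less.prems in \<open>auto simp: sylvester_Suc intro: pos anti\<close>)
    then have "1 / real (sylv_prod j) \<le> sum x {j..d}"
      using prod_le_sum[OF \<open>j > 0\<close> less.prems] by (simp add: prod_inverse_sylvester)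
    with neg sum_tail[OF less.prems] show False by simp
  qed
qed

end

text \<open>The competitors are the sequences \<open>1 / s\<^sub>1, \<dots>, 1 / s\<^sub>k\<close> continued by equal terms
  \<open>equal_tail d k\<close> up to sum \<open>1\<close>, and \<open>tail_value d k\<close> is the product of all but the last two
  terms.\<close>

definition equal_tail :: "nat \<Rightarrow> nat \<Rightarrow> real" where
  "equal_tail d k = 1 / (real (d + 1 - k) * real (sylv_prod k))"

lemma equal_tail_pos: "k \<le> d \<Longrightarrow> equal_tail d k > 0"
  by (simp add: equal_tail_def)

definition tail_value :: "nat \<Rightarrow> nat \<Rightarrow> real" where
  "tail_value d k = 1 / real (sylv_prod k) * equal_tail d k ^ (d - 1 - k)"

lemma sylv_prod_ge_6: "2 \<le> k \<Longrightarrow> 6 \<le> sylv_prod k"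
  using sylv_prod_mono[of 2 k] by (simp add: numeral_2_eq_2 sylv_prod_Suc)

lemma tail_value_Suc_less:
  assumes "d \<ge> 5" "k + 2 < d"
  shows "tail_value d (Suc k) < tail_value d k"
proof -
  define t where "t = d + 1 - k"
  define U where "U = sylv_prod k"
  have t: "t \<ge> 4" using assms by (simp add: t_def)
  \<comment> \<open>The two small values of \<open>U\<close> come from \<open>k = 0\<close> and
    \<open>k = 1\<close> and rely on \<open>d >= 5\<close>; from \<open>k = 2\<close> on,
    \<open>t >= 4\<close> is enough.\<close>
  have "U = 1 \<and> 6 \<le> t \<or> U = 2 \<and> 5 \<le> t \<or> 6 \<le> U"
  proof (cases "k \<ge> 2")
    case False
    then have "k = 0 \<or> k = 1" by auto
    then show ?thesis using assms by (auto simp: U_def t_def sylv_prod_Suc)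
  qed (simp add: U_def sylv_prod_ge_6)
  from power_step_bound[OF t this]
  have bound: "real U * real t ^ (t - 2) < (real t - 1) ^ (t - 3) * (real U + 1) ^ (t - 2)" .
  have U: "real U > 0" by (simp add: U_def)
  have e: "d - 1 - k = t - 2" "d - 1 - Suc k = t - 3" "t - 2 = Suc (t - 3)" "real (d + 1 - Suc k) = real t - 1"
    using assms by (auto simp: t_def)
  have v: "tail_value d k = 1 / (real U * (real t * real U) ^ (t - 2))"
    unfolding tail_value_def equal_tail_def e U_def[symmetric] t_def[symmetric]
    by (simp add: power_divide)
  have w: "tail_value d (Suc k) =
      1 / (real U * (real U + 1) * ((real t - 1) * (real U * (real U + 1))) ^ (t - 3))"
    unfolding tail_value_def equal_tail_def e sylv_prod_Suc U_def[symmetric]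
    by (simp add: power_divide distrib_left add.commute)
  have "real U * (real t * real U) ^ (t - 2) = (real U * real t ^ (t - 2)) * real U ^ (t - 2)"
    by (simp add: power_mult_distrib)
  also have "\<dots> < ((real t - 1) ^ (t - 3) * (real U + 1) ^ (t - 2)) * real U ^ (t - 2)"
    using bound U by (intro mult_strict_right_mono) auto
  also have "\<dots> = real U * (real U + 1) * ((real t - 1) * (real U * (real U + 1))) ^ (t - 3)"
    unfolding e(3) by (simp add: power_mult_distrib)
  finally show ?thesis
    unfolding v w using U t by (intro divide_strict_left_mono) auto
qed

lemma tail_value_ge:
  assumes "d \<ge> 5" "k \<le> j" "j + 2 \<le> d"
  shows "tail_value d j \<le> tail_value d k"
  using assms(2,3)
proof (induction j rule: dec_induct)
  case (step n)
  then show ?case using tail_value_Suc_less[of d n] assms(1) by simp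
qed simp

text \<open>On the segment of comparison sequences between two consecutive candidates the product
  is log-concave, so it exceeds the smaller of its values at the ends.\<close>

lemma mixed_tail_greater:
  assumes d: "d \<ge> 5" "k + 2 < d" and z: "equal_tail d (Suc k) < z" "z \<le> equal_tail d k"
  defines "c \<equiv> 1 / real (sylv_prod k) - real (d - k) * z"
  shows "tail_value d (d - 2) < 1 / real (sylv_prod k) * (c * z ^ (d - 2 - k))"
proof -
  define t where "t = d + 1 - k"
  define U where "U = real (sylv_prod k)"
  define h where "h = equal_tail d k"
  define h' where "h' = equal_tail d (Suc k)"
  have U: "U \<ge> 1" using sylv_prod_pos[of k] by (simp add: U_def Suc_le_eq)
  have t: "real t \<ge> 4" "real (d - k) = real t - 1" using d by (auto simp: t_def)
  have hh: "h = 1 / (real t * U)" "h' = 1 / ((real t - 1) * (U * (U + 1)))"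
    using d t by (auto simp: h_def h'_def equal_tail_def U_def t_def sylv_prod_Suc distrib_left add.commute)
  have hpos: "h > 0" "h' > 0" using t U by (auto simp: hh)
  have zz: "h' < z" "z \<le> h" using z by (auto simp: h_def h'_def)
  \<comment> \<open>\<open>s\<close> is the position on the segment. At \<open>s = 0\<close> the
    sequence has one more Sylvester reciprocal, \<open>c = 1 / (U + 1)\<close>; at
    \<open>s = 1\<close> the term \<open>c\<close> joins the equal tail \<open>h\<close>.\<close>
  define s where "s = (z - h') / (h - h')"
  have s: "0 < s" "s \<le> 1" using zz by (auto simp: s_def)
  have zs: "z = (1 - s) * h' + s * h"
  proof -
    have "s * (h - h') = z - h'" using zz by (simp add: s_def)
    then show ?thesis by (simp add: algebra_simps)
  qed
  have ch: "1 / U - (real t - 1) * h = h" "1 / U - (real t - 1) * h' = 1 / (U + 1)"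
  proof -
    have "(real t - 1) * h' = 1 / (U * (U + 1))" using t U by (simp add: hh)
    moreover have "1 / U - 1 / (U * (U + 1)) = 1 / (U + 1)" using U by (simp add: divide_simps)
    ultimately show "1 / U - (real t - 1) * h' = 1 / (U + 1)" by metis
    have "(real t - 1) * h = 1 / U - 1 / (real t * U)" using t U by (simp add: hh diff_divide_distrib)
    then show "1 / U - (real t - 1) * h = h" by (simp add: hh)
  qed
  have "c = (1 - s) * (1 / U - (real t - 1) * h') + s * (1 / U - (real t - 1) * h)"
    unfolding c_def t zs U_def[symmetric] by (simp add: algebra_simps diff_divide_distrib)
  then have cs: "c = (1 - s) * (1 / (U + 1)) + s * h" by (simp only: ch)
  have conc: "(1 - s) * ln a + s * ln b \<le> ln ((1 - s) * a + s * b)" if "a > 0" "b > 0" for a b :: real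
    using concave_onD[OF ln_concave, of s a b] s that by simp
  have zpos: "z > 0" using zz hpos by linarith
  have cpos: "c > 0" unfolding cs using s hpos U
    by (intro add_nonneg_pos mult_nonneg_nonneg mult_pos_pos) auto
  define e where "e = d - 2 - k"
  have e: "d - 1 - k = Suc e" "d - 1 - Suc k = e" using d by (auto simp: e_def)
  define f where "f = ln (tail_value d k)"
  define f' where "f' = ln (tail_value d (Suc k))"
  have f: "f = - ln U + (ln h + real e * ln h)"
    unfolding f_def tail_value_def e h_def[symmetric] U_def[symmetric] using U hpos
    by (simp add: ln_mult ln_div ln_realpow)
  have f': "f' = - ln U + (ln (1 / (U + 1)) + real e * ln h')"
  proof -
    have "real (sylv_prod (Suc k)) = U * (U + 1)"
      by (simp add: sylv_prod_Suc U_def distrib_left add.commute)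
    then have "tail_value d (Suc k) = 1 / U * (1 / (U + 1) * h' ^ e)"
      unfolding tail_value_def e h'_def by simp
    then show ?thesis unfolding f'_def using U hpos
      by (simp add: ln_mult ln_div ln_realpow)
  qed
  have vpos: "tail_value d j > 0" if "j \<le> d" for j
    using equal_tail_pos[OF that] by (simp add: tail_value_def)
  \<comment> \<open>Strictness comes from \<open>s > 0\<close> and \<open>f' < f\<close>. The end
    \<open>s = 0\<close> has to stay excluded: for \<open>k = d - 3\<close> its value is the minimum
    itself.\<close>
  have "ln (tail_value d (d - 2)) \<le> f'"
    unfolding f'_def using d vpos[of "d - 2"] by (intro ln_mono tail_value_ge) auto
  moreover have "f' < f"
    unfolding f_def f'_def using d vpos[of "Suc k"] vpos[of k] tail_value_Suc_less[OF d] by simp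
  then have "s * f' < s * f" using s by simp
  ultimately have "ln (tail_value d (d - 2)) < (1 - s) * f' + s * f"
    by (simp add: algebra_simps)
  also have "\<dots> = - ln U + (((1 - s) * ln (1 / (U + 1)) + s * ln h) + real e * ((1 - s) * ln h' + s * ln h))"
    unfolding f f' by (simp add: algebra_simps)
  also have "\<dots> \<le> - ln U + (ln c + real e * ln z)"
    unfolding cs zs using U hpos by (intro add_left_mono add_mono mult_left_mono conc) auto
  also have "\<dots> = ln (1 / U * (c * z ^ e))"
    using U cpos zpos by (simp add: ln_mult ln_div ln_realpow)
  finally show ?thesis
    using vpos[of "d - 2"] U cpos zpos by (simp add: U_def e_def)
qed

lemma crossing:
  fixes h :: "nat \<Rightarrow> real"
  assumes "z \<le> h 0" "h m < z"
  obtains k where "k < m" "z \<le> h k" "h (Suc k) < z"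
  using assms
proof (induction m arbitrary: thesis)
  case (Suc m)
  show ?case
  proof (cases "h m < z")
    case True
    obtain k where "k < m" "z \<le> h k" "h (Suc k) < z" by (rule Suc.IH) (use Suc True in auto)
    then show ?thesis by (intro Suc.prems(1)[of k]) auto
  next
    case False
    then show ?thesis using Suc.prems by (intro Suc.prems(1)[of m]) auto
  qed
qed simp

section \<open>Identification of the minimizer\<close>

context product_sum
begin

text \<open>The last two terms are absent from the product, so only their mean \<open>z\<close>
  matters. If \<open>z\<close> exceeds the extremal tail \<open>H\<close>, a competitor ending in
  \<open>z\<close> shows the product to be too large. Otherwise the extremal sequence itself is an
  admissible comparison, and the equality clause of majorization applies.\<close>

lemma extremal_coordinates:
  assumes d: "d \<ge> 5"
    and le: "prod x {..<d - 1} \<le> 1 / (3 * real (sylv_prod (d - 2)) ^ 2)"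
  shows "i < d - 2 \<Longrightarrow> x i = 1 / real (sylvester (Suc i))"
    and "d - 2 \<le> i \<Longrightarrow> i \<le> d \<Longrightarrow> x i = 1 / (3 * real (sylv_prod (d - 2)))"
proof -
  define H where "H = 1 / (3 * real (sylv_prod (d - 2)))"
  define z where "z = (x (d - 1) + x d) / 2"
  have H: "equal_tail d (d - 2) = H" "H > 0"
    using d by (auto simp: equal_tail_def H_def)
  have value_H: "tail_value d (d - 2) = 1 / (3 * real (sylv_prod (d - 2)) ^ 2)"
  proof -
    have "d - 1 - (d - 2) = 1" using d by simp
    then show ?thesis unfolding tail_value_def H by (simp add: H_def power2_eq_square)
  qed
  have ivl: "{d - 1..d} = {d - 1, d}" using d by auto
  have tail_z: "sum x {d - 1..d} = 2 * z" using d unfolding ivl by (simp add: z_def)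
  have zpos: "z > 0" using pos[of "d - 1"] pos[of d] by (simp add: z_def)
  have z_le: "z \<le> x i" if "i \<le> d - 1" for i
    using anti_mono[of i "d - 1"] anti[of "d - 1"] that d by (simp add: z_def)
  have tail_ge: "real (d + 1 - j) * z \<le> sum x {j..d}" if "j \<le> d - 1" for j
  proof -
    have "{j..d} = {j..<d - 1} \<union> {d - 1..d}" using that d by auto
    then have "sum x {j..d} = sum x {j..<d - 1} + 2 * z"
      unfolding tail_z[symmetric] by (simp add: sum.union_disjoint ivl_disj_int)
    moreover have "sum x {j..<d - 1} \<ge> (\<Sum>i\<in>{j..<d - 1}. z)"
      by (intro sum_mono z_le) auto
    moreover have "real (d + 1 - j) = real (d - 1 - j) + 2" using that d by auto
    ultimately show ?thesis by (simp add: algebra_simps)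
  qed
  have "z \<le> H"
  proof (rule ccontr)
    assume "\<not> z \<le> H"
    moreover have "z \<le> equal_tail d 0"
      using tail_ge[of 0] total d by (simp add: equal_tail_def atMost_atLeast0 field_simps)
    ultimately obtain k where k: "k < d - 2" "z \<le> equal_tail d k" "equal_tail d (Suc k) < z"
      using crossing[of z "equal_tail d" "d - 2"] H by auto
    \<comment> \<open>The competitor has \<open>k\<close> Sylvester reciprocals and
      \<open>d - k\<close> terms \<open>z\<close>; \<open>c\<close> is the one term that completes
      the total to 1.\<close>
    define c where "c = 1 / real (sylv_prod k) - real (d - k) * z"
    define a where "a i = (if i < k then 1 / real (sylvester (Suc i)) else if i = k then c else z)" for i
    have "c > 0"
    proof -
      have "real (d - k) * z \<le> real (d - k) * equal_tail d k" using k by (intro mult_left_mono) auto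
      also have "\<dots> < real (d + 1 - k) * equal_tail d k"
        using k equal_tail_pos[of k d] by (intro mult_strict_right_mono) auto
      also have "\<dots> = 1 / real (sylv_prod k)" using k by (simp add: equal_tail_def)
      finally show ?thesis by (simp add: c_def)
    qed
    have sum_a: "sum a {..<j} = 1 - real (d + 1 - j) * z" if "k < j" "j \<le> d - 1" for j
    proof -
      have "{..<j} = {..<k} \<union> ({k} \<union> {Suc k..<j})" "{..<k} \<inter> {Suc k..<j} = {}"
        using that by auto
      then have "sum a {..<j} = sum a {..<k} + (a k + sum a {Suc k..<j})"
        by (simp add: sum.union_disjoint)
      also have "sum a {..<k} = 1 - 1 / real (sylv_prod k)"
        unfolding sum_inverse_sylvester[symmetric] by (intro sum.cong) (auto simp: a_def)
      also have "sum a {Suc k..<j} = (\<Sum>i\<in>{Suc k..<j}. z)"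
        by (intro sum.cong) (auto simp: a_def)
      also have "a k = c" by (simp add: a_def)
      finally show ?thesis
        using that by (simp add: c_def algebra_simps of_nat_diff)
    qed
    have "prod a {..<d - 1} \<le> prod x {..<d - 1}"
    proof (rule prod_mono_partial_sums)
      fix j assume j: "j < d - 1"
      show "sum x {..<j} \<le> sum a {..<j}"
      proof (cases "j \<le> k")
        case True
        then have "sum a {..<j} = 1 - 1 / real (sylv_prod j)"
          unfolding sum_inverse_sylvester[symmetric] by (intro sum.cong) (auto simp: a_def)
        then show ?thesis using partial_sum_le[of j] j by simp
      next
        case False
        then show ?thesis using sum_a[of j] tail_ge[of j] sum_tail[of j] j by linarith
      qed
    next
      show "sum a {..<d - 1} \<le> sum x {..<d - 1}"
        using sum_a[of "d - 1"] sum_tail[of "d - 1"] tail_z k d by simp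
    qed (use \<open>c > 0\<close> zpos in \<open>auto simp: a_def sylvester_Suc intro: pos anti\<close>)
    also have "prod a {..<d - 1} = 1 / real (sylv_prod k) * (c * z ^ (d - 2 - k))"
    proof -
      have "{..<d - 1} = {..<k} \<union> ({k} \<union> {Suc k..<d - 1})" "{..<k} \<inter> {Suc k..<d - 1} = {}"
        using k by auto
      then have "prod a {..<d - 1} = prod a {..<k} * (a k * prod a {Suc k..<d - 1})"
        by (simp add: prod.union_disjoint)
      also have "prod a {..<k} = 1 / real (sylv_prod k)"
        unfolding prod_inverse_sylvester[symmetric] by (intro prod.cong) (auto simp: a_def)
      also have "prod a {Suc k..<d - 1} = (\<Prod>i\<in>{Suc k..<d - 1}. z)"
        by (intro prod.cong) (auto simp: a_def)
      finally show ?thesis by (simp add: a_def numeral_2_eq_2)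
    qed
    finally show False
      using mixed_tail_greater[OF d _ k(3) k(2)] k(1) le value_H unfolding c_def by linarith
  qed
  define a where "a i = (if i < d - 2 then 1 / real (sylvester (Suc i)) else H)" for i
  have ivl': "{..<d - 1} = insert (d - 2) {..<d - 2}" using d by auto
  have sum_a: "sum a {..<j} = 1 - 1 / real (sylv_prod j)" if "j \<le> d - 2" for j
    unfolding sum_inverse_sylvester[symmetric] using that by (intro sum.cong) (auto simp: a_def)
  have sum_a': "sum a {..<d - 1} = 1 - 2 * H"
    unfolding ivl' using sum_a[of "d - 2"] by (simp add: a_def H_def)
  have prod_a: "prod a {..<d - 1} = 1 / (3 * real (sylv_prod (d - 2)) ^ 2)"
  proof -
    have "prod a {..<d - 2} = 1 / real (sylv_prod (d - 2))"
      unfolding prod_inverse_sylvester[symmetric] by (intro prod.cong) (auto simp: a_def)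
    then show ?thesis unfolding ivl' by (simp add: a_def H_def power2_eq_square)
  qed
  have eq: "x i = a i" if "i < d - 1" for i
  proof (rule prod_mono_partial_sums(2)[of "d - 1" x a])
    fix j assume "j < d - 1"
    then show "sum x {..<j} \<le> sum a {..<j}"
      using sum_a[of j] partial_sum_le[of j] by simp
  next
    show "sum a {..<d - 1} \<le> sum x {..<d - 1}"
      using sum_a' sum_tail[of "d - 1"] tail_z \<open>z \<le> H\<close> by simp
  next
    show "prod x {..<d - 1} \<le> prod a {..<d - 1}" using le prod_a by simp
  qed (use H(2) that in \<open>auto simp: a_def sylvester_Suc intro!: pos anti\<close>)
  then have "sum x {..<d - 1} = sum a {..<d - 1}" by (intro sum.cong) auto
  \<comment> \<open>The equality clause stops before the last two terms. Their mean is
    \<open>H\<close> and neither exceeds \<open>x (d - 2) = H\<close>, so both equal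
    \<open>H\<close>.\<close>
  then have "x (d - 1) + x d = 2 * H"
    using sum_a' sum_tail[of "d - 1"] tail_z by (simp add: z_def)
  moreover have "x (d - 2) = H" using eq[of "d - 2"] d by (simp add: a_def)
  moreover have "x (d - 1) \<le> x (d - 2)" "x d \<le> x (d - 1)"
    using d by (auto intro: anti_mono)
  ultimately have "x (d - 2) = H" "x (d - 1) = H" "x d = H" by linarith+
  then show "x i = 1 / (3 * real (sylv_prod (d - 2)))" if "d - 2 \<le> i" "i \<le> d"
  proof -
    have "i = d - 2 \<or> i = d - 1 \<or> i = d" using that by auto
    with \<open>x (d - 2) = H\<close> \<open>x (d - 1) = H\<close> \<open>x d = H\<close> show ?thesis unfolding H_def by auto
  qed
  show "i < d - 2 \<Longrightarrow> x i = 1 / real (sylvester (Suc i))"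
    using eq[of i] by (simp add: a_def)
qed

end

section \<open>Packing and tiling by boxes\<close>

lemma sum_atMost_last: "sum f {..d} = sum f {..<d} + f d" for d :: nat
  unfolding lessThan_Suc_atMost[symmetric] by (rule sum.lessThan_Suc)

lemma sum_atLeast1_shift: "(\<Sum>j\<in>{1..d}. g j) = (\<Sum>i<d. g (Suc i))"
  by (rule sum.reindex_bij_witness[of _ Suc "\<lambda>i. i - 1"]) auto

lemma int_span_image:
  assumes "inj_on v I" "finite I"
  shows "int_span (v ` I) = range (\<lambda>c. \<Sum>i\<in>I. of_int (c i) *\<^sub>R v i)"
proof (intro equalityI subsetI)
  fix x assume "x \<in> int_span (v ` I)"
  then obtain T c where T: "finite T" "T \<subseteq> v ` I" "x = (\<Sum>y\<in>T. of_int (c y) *\<^sub>R y)"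
    unfolding int_span_def by auto
  define c' where "c' i = (if v i \<in> T then c (v i) else 0)" for i
  have "T = v ` {i \<in> I. v i \<in> T}" using T by auto
  then have "x = (\<Sum>y\<in>v ` {i \<in> I. v i \<in> T}. of_int (c y) *\<^sub>R y)" using T by simp
  also have "\<dots> = (\<Sum>i\<in>{i \<in> I. v i \<in> T}. of_int (c (v i)) *\<^sub>R v i)"
    using assms by (subst sum.reindex) (auto intro: inj_on_subset)
  also have "\<dots> = (\<Sum>i\<in>I. of_int (c' i) *\<^sub>R v i)"
    using assms by (intro sum.mono_neutral_cong_left) (auto simp: c'_def)
  finally show "x \<in> range (\<lambda>c. \<Sum>i\<in>I. of_int (c i) *\<^sub>R v i)" by blast
next
  fix x assume "x \<in> range (\<lambda>c. \<Sum>i\<in>I. of_int (c i) *\<^sub>R v i)"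
  then obtain c where c: "x = (\<Sum>i\<in>I. of_int (c i) *\<^sub>R v i)" by auto
  have "x = (\<Sum>y\<in>v ` I. of_int (c (inv_into I v y)) *\<^sub>R y)"
    using assms unfolding c by (subst sum.reindex) (auto intro!: sum.cong)
  then show "x \<in> int_span (v ` I)"
    unfolding int_span_def using assms(2)
    by (intro CollectI exI[of _ "v ` I"] exI[of _ "\<lambda>y. c (inv_into I v y)"]) auto
qed

lemma small_multiple_zero:
  fixes m z :: int
  assumes "m dvd z" "\<bar>z\<bar> < m" shows "z = 0"
  using assms zdvd_not_zless[of "\<bar>z\<bar>" m] by (cases "z = 0") auto

text \<open>The barycentric coordinates of a lattice point \<open>x\<close> are \<open>(b i + l i x) / M\<close>, where
  \<open>b i / M\<close> are those of the origin.\<close>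

locale integral_simplex =
  fixes N :: "'a::real_vector set" and d :: nat and v :: "nat \<Rightarrow> 'a"
    and b :: "nat \<Rightarrow> int" and M :: int and l :: "nat \<Rightarrow> 'a \<Rightarrow> int"
  assumes diff_mem: "x \<in> N \<Longrightarrow> y \<in> N \<Longrightarrow> x - y \<in> N"
    and l_diff: "x \<in> N \<Longrightarrow> y \<in> N \<Longrightarrow> l i (x - y) = l i x - l i y"
    and l_sum: "x \<in> N \<Longrightarrow> (\<Sum>i\<le>d. l i x) = 0"
    and v_mem: "i \<le> d \<Longrightarrow> v i \<in> N"
    and l_v: "i \<le> d \<Longrightarrow> j \<le> d \<Longrightarrow> l j (v i) = (if i = j then M else 0) - b j"
    and b_pos: "i \<le> d \<Longrightarrow> 0 < b i"
    and b_sum: "sum b {..d} = M"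
    and canonical: "x \<in> N \<Longrightarrow> (\<And>i. i \<le> d \<Longrightarrow> - b i < l i x) \<Longrightarrow> x = 0"
begin

lemma zero_mem: "0 \<in> N"
  using diff_mem[OF v_mem v_mem, of 0 0] by simp

lemma l_zero [simp]: "l i 0 = 0"
  using l_diff[OF zero_mem zero_mem, of i] by simp

lemma uminus_mem: "x \<in> N \<Longrightarrow> - x \<in> N"
  using diff_mem[OF zero_mem] by fastforce

lemma l_uminus: "x \<in> N \<Longrightarrow> l i (- x) = - l i x"
  using l_diff[OF zero_mem, of x i] by simp

lemma add_mem: "x \<in> N \<Longrightarrow> y \<in> N \<Longrightarrow> x + y \<in> N"
  using diff_mem[of x "- y"] uminus_mem[of y] by simp

lemma l_add: "x \<in> N \<Longrightarrow> y \<in> N \<Longrightarrow> l i (x + y) = l i x + l i y"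
  using l_diff[of x "- y" i] uminus_mem[of y] l_uminus[of y i] by simp

lemma scale:
  assumes x: "x \<in> N"
  shows "of_int k *\<^sub>R x \<in> N \<and> l i (of_int k *\<^sub>R x) = k * l i x"
proof (induction k rule: int_induct[where k = 0])
  case (step1 k)
  then show ?case using add_mem[OF _ x] l_add[OF _ x] by (simp add: scaleR_left_distrib distrib_right)
next
  case (step2 k)
  then show ?case using diff_mem[OF _ x] l_diff[OF _ x] by (simp add: scaleR_left_diff_distrib left_diff_distrib)
qed (simp add: zero_mem)

lemma scale_mem: "x \<in> N \<Longrightarrow> of_int k *\<^sub>R x \<in> N"
  and l_scale: "x \<in> N \<Longrightarrow> l i (of_int k *\<^sub>R x) = k * l i x"
  using scale by blast+

definition comb :: "(nat \<Rightarrow> int) \<Rightarrow> 'a" where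
  "comb c = (\<Sum>i\<le>d. of_int (c i) *\<^sub>R v i)"

lemma sum_mem:
  assumes "finite I" "\<And>i. i \<in> I \<Longrightarrow> f i \<in> N"
  shows "sum f I \<in> N \<and> l j (sum f I) = (\<Sum>i\<in>I. l j (f i))"
  using assms by (induction I rule: finite_induct) (auto simp: zero_mem add_mem l_add)

lemma comb_mem: "comb c \<in> N"
  unfolding comb_def using sum_mem[of "{..d}"] scale_mem[OF v_mem] by simp

text \<open>Modulo \<open>M\<close> only a multiple of \<open>b\<close> survives, so shifts by
  multiples of \<open>b\<close> account for the whole vertex lattice in the packing.\<close>

lemma l_comb:
  assumes "j \<le> d"
  shows "l j (comb c) = M * c j - (\<Sum>i\<le>d. c i) * b j"
proof -
  have "l j (comb c) = (\<Sum>i\<le>d. l j (of_int (c i) *\<^sub>R v i))"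
    unfolding comb_def using sum_mem[of "{..d}"] scale_mem[OF v_mem] by simp
  also have "\<dots> = (\<Sum>i\<le>d. (if i = j then M * c j else 0) - c i * b j)"
    using assms by (intro sum.cong) (auto simp: l_scale v_mem l_v algebra_simps)
  also have "\<dots> = M * c j - (\<Sum>i\<le>d. c i) * b j"
    using assms by (simp add: sum_subtractf sum_distrib_right)
  finally show ?thesis .
qed

lemma comb_uminus: "- comb c = comb (\<lambda>i. - c i)"
  by (simp add: comb_def sum_negf)

lemma M_pos: "M > 0"
  unfolding b_sum[symmetric] using b_pos by (intro sum_pos) auto

lemma b_le_M: "i \<le> d \<Longrightarrow> b i \<le> M"
  unfolding b_sum[symmetric] using b_pos by (intro member_le_sum) (auto intro: less_imp_le)

text \<open>Either \<open>x\<close> or \<open>- x\<close> has a nonnegative last coordinate.\<close>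

lemma canonical_symmetric:
  assumes x: "x \<in> N" and small: "\<And>i. i < d \<Longrightarrow> \<bar>l i x\<bar> < b i"
  shows "x = 0"
proof (cases "l d x \<ge> 0")
  case True
  show ?thesis
  proof (rule canonical[OF x])
    fix i assume "i \<le> d"
    then show "- b i < l i x" using small[of i] True b_pos[of d] by (cases "i = d") auto
  qed
next
  case False
  have "- x = 0"
  proof (rule canonical[OF uminus_mem[OF x]])
    fix i assume "i \<le> d"
    then show "- b i < l i (- x)"
      using small[of i] False b_pos[of d] by (cases "i = d") (auto simp: l_uminus[OF x])
  qed
  then show ?thesis by simp
qed

text \<open>The congruence on box points used here is that of the lattice spanned by
  \<open>M p - (\<Sum> p) b\<close>, whose determinant is the right-hand side.\<close>

lemma prod_le_sum_tail:
  assumes n: "0 < n" "n \<le> d"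
  shows "prod b {..<n} \<le> M ^ (n - 1) * sum b {n..d}"
proof (rule ccontr)
  assume gt: "\<not> ?thesis"
  define \<sigma> where "\<sigma> = sum b {n..d}"
  have \<sigma>: "\<sigma> > 0" unfolding \<sigma>_def using b_pos n by (intro sum_pos) auto
  have split_b: "sum b {..<n} = M - \<sigma>"
  proof -
    have "{..d} = {..<n} \<union> {n..d}" "{..<n} \<inter> {n..d} = {}" using n by auto
    then show ?thesis unfolding b_sum[symmetric] \<sigma>_def by (simp add: sum.union_disjoint)
  qed
  define B where "B = (\<Pi>\<^sub>E i\<in>{..<n}. {0..<b i})"
  define C where "C = {0..<\<sigma>} \<times> (\<Pi>\<^sub>E i\<in>{1..<n}. {0..<M})"
  define q where "q y = sum y {..<n} div \<sigma>" for y :: "nat \<Rightarrow> int"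
  \<comment> \<open>No residue is kept for index 0; it is recovered from the sum. This is what
    limits the number of values to \<open>\<sigma> * M ^ (n - 1)\<close>.\<close>
  define \<Phi> where "\<Phi> y = (sum y {..<n} mod \<sigma>, restrict (\<lambda>i. (y i + q y * b i) mod M) {1..<n})"
    for y :: "nat \<Rightarrow> int"
  have "int (card B) = prod b {..<n}"
    using b_pos n by (simp add: B_def card_PiE) (intro prod.cong, auto intro: less_imp_le)
  moreover have "int (card C) = \<sigma> * M ^ (n - 1)"
    using \<sigma> M_pos by (simp add: C_def card_PiE card_cartesian_product)
  ultimately have "card C < card B"
    using gt by (simp add: \<sigma>_def mult.commute flip: of_nat_less_iff)
  moreover have "\<Phi> ` B \<subseteq> C"
    using \<sigma> M_pos by (auto simp: \<Phi>_def C_def)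
  moreover have "finite C" by (auto simp: C_def intro: finite_PiE)
  ultimately have "\<not> inj_on \<Phi> B"
    by (meson card_inj_on_le not_less)
  then obtain y y' where y: "y \<in> B" "y' \<in> B" "\<Phi> y = \<Phi> y'" "y \<noteq> y'"
    by (auto simp: inj_on_def)
  have box: "\<bar>y i - y' i\<bar> < b i" if "y \<in> B" "y' \<in> B" "i < n" for y y' i
  proof -
    have "y i \<in> {0..<b i}" "y' i \<in> {0..<b i}" 
      using PiE_mem[OF that(1)[unfolded B_def], of i] PiE_mem[OF that(2)[unfolded B_def], of i] that(3)
      by simp_all
    then show ?thesis by auto
  qed
  have sum_diff: "(\<Sum>i<n. y i - y' i) = (q y - q y') * \<sigma>" if "\<Phi> y = \<Phi> y'" for y y'
  proof -
    have "sum y {..<n} mod \<sigma> = sum y' {..<n} mod \<sigma>" using that by (simp add: \<Phi>_def)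
    then have "sum y {..<n} - sum y' {..<n} = q y * \<sigma> - q y' * \<sigma>"
      unfolding q_def by (metis add_diff_cancel_right div_mult_mod_eq)
    then show ?thesis by (simp add: sum_subtractf algebra_simps)
  qed
  have dvd: "M dvd (y i - y' i) + (q y - q y') * b i" if "\<Phi> y = \<Phi> y'" "i \<in> {1..<n}" for y y' i
  proof -
    have "(y i + q y * b i) mod M = (y' i + q y' * b i) mod M"
      using that by (auto simp: \<Phi>_def restrict_def fun_eq_iff split: if_splits)
    then show ?thesis by (simp add: mod_eq_dvd_iff algebra_simps)
  qed
  \<comment> \<open>A collision with \<open>Q > 0\<close> produces a lattice point with coordinates
    \<open>y' i - y i > - b i\<close> below \<open>n\<close> and \<open>Q * b i > 0\<close> from
    \<open>n\<close> on, an interior point other than the origin. Exchanging \<open>y\<close> and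
    \<open>y'\<close> covers \<open>Q < 0\<close>.\<close>
  have positive: False if "y \<in> B" "y' \<in> B" "\<Phi> y = \<Phi> y'" "q y' < q y" for y y'
  proof -
    define Q where "Q = q y - q y'"
    have total: "(\<Sum>i<n. (y i - y' i) + Q * b i) = Q * M"
      unfolding sum.distrib sum_diff[OF that(3)] sum_distrib_left[symmetric] split_b Q_def
      by (simp add: algebra_simps)
    have all_dvd: "M dvd (y i - y' i) + Q * b i" if "i < n" for i
    proof (cases "i = 0")
      case False
      then show ?thesis using dvd[OF \<open>\<Phi> y = \<Phi> y'\<close>] that by (simp add: Q_def)
    next
      case True
      have "{..<n} = insert 0 {1..<n}" using n by auto
      then have "(y 0 - y' 0) + Q * b 0 = Q * M - (\<Sum>i\<in>{1..<n}. (y i - y' i) + Q * b i)"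
        using total by simp
      moreover have "M dvd (\<Sum>i\<in>{1..<n}. (y i - y' i) + Q * b i)"
        by (intro dvd_sum) (use dvd[OF \<open>\<Phi> y = \<Phi> y'\<close>] in \<open>simp add: Q_def\<close>)
      ultimately show ?thesis using True by simp
    qed
    define p where "p i = (if i < n then ((y i - y' i) + Q * b i) div M else 0)" for i
    have Mp: "M * p i = (y i - y' i) + Q * b i" if "i < n" for i
      using all_dvd[OF that] that by (simp add: p_def)
    have "M * (\<Sum>i<n. p i) = Q * M"
      unfolding sum_distrib_left total[symmetric] by (intro sum.cong) (auto simp: Mp)
    then have "(\<Sum>i<n. p i) = Q" using M_pos by simp
    moreover have "(\<Sum>i\<le>d. p i) = (\<Sum>i<n. p i)"
      using n by (intro sum.mono_neutral_right) (auto simp: p_def)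
    ultimately have sum_p: "(\<Sum>i\<le>d. - p i) = - Q" by (simp add: sum_negf)
    have lc: "l i (comb (\<lambda>i. - p i)) = Q * b i - M * p i" if "i \<le> d" for i
      using l_comb[OF that, of "\<lambda>i. - p i"] by (simp add: sum_p)
    have "comb (\<lambda>i. - p i) = 0"
    proof (rule canonical[OF comb_mem])
      fix i assume i: "i \<le> d"
      show "- b i < l i (comb (\<lambda>i. - p i))"
      proof (cases "i < n")
        case True
        then show ?thesis using lc[OF i] Mp[OF True] box[OF that(1,2) True] by simp
      next
        case False
        have "Q * b i > 0" using that(4) b_pos[OF i] by (simp add: Q_def)
        then show ?thesis using lc[OF i] False b_pos[OF i] by (simp add: p_def)
      qed
    qed
    then have "Q * b d = 0" using lc[of d] n by (simp add: p_def)
    then show False using that(4) b_pos[of d] by (simp add: Q_def)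
  qed
  have "q y = q y'"
    using positive[OF y(1,2,3)] positive[OF y(2,1) y(3)[symmetric]]
    by (metis linorder_neqE)
  have eq: "y i = y' i" if "i \<in> {1..<n}" for i
  proof -
    have "M dvd y i - y' i" using dvd[OF y(3) that] \<open>q y = q y'\<close> by simp
    moreover have "\<bar>y i - y' i\<bar> < M" using box[OF y(1,2), of i] b_le_M[of i] that n by simp
    ultimately have "y i - y' i = 0" by (rule small_multiple_zero)
    then show ?thesis by simp
  qed
  have "y 0 = y' 0"
  proof -
    have "{..<n} = insert 0 {1..<n}" using n by auto
    then have "(\<Sum>i<n. y i - y' i) = y 0 - y' 0" using eq by simp
    then show ?thesis using sum_diff[OF y(3)] \<open>q y = q y'\<close> by simp
  qed
  with eq have "y i = y' i" if "i < n" for i using that by (cases "i = 0") auto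
  then have "y = y'" using y(1,2) unfolding B_def by (intro PiE_ext) auto
  with y(4) show False by simp
qed

section \<open>Placing boxes in a finite torus\<close>

definition torus :: "(nat \<Rightarrow> int) set" where
  "torus = (\<Pi>\<^sub>E i\<in>{..<d}. {0..<M})"

text \<open>A label consists of a coset representative, a multiple of \<open>b\<close>, and a point
  of the box; the first two locate the box modulo \<open>M\<close>.\<close>

definition boxes :: "'a set \<Rightarrow> nat \<Rightarrow> ('a \<times> nat \<times> (nat \<Rightarrow> int)) set" where
  "boxes R K = R \<times> {..<K} \<times> (\<Pi>\<^sub>E i\<in>{..<d}. {0..<b i})"

definition place :: "'a \<times> nat \<times> (nat \<Rightarrow> int) \<Rightarrow> nat \<Rightarrow> int" where
  "place = (\<lambda>(r, k, c). restrict (\<lambda>i. (l i r + int k * b i + c i) mod M) {..<d})"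

lemma finite_torus: "finite torus"
  unfolding torus_def by (intro finite_PiE) simp_all

lemma card_torus: "int (card torus) = M ^ d"
  using M_pos by (simp add: torus_def card_PiE)

lemma card_boxes: "int (card (boxes R K)) = int (card R * K) * prod b {..<d}"
proof -
  have "int (card (\<Pi>\<^sub>E i\<in>{..<d}. {0..<b i})) = prod b {..<d}"
    using b_pos by (simp add: card_PiE) (intro prod.cong, auto intro: less_imp_le)
  then show ?thesis by (simp add: boxes_def card_cartesian_product)
qed

lemma place_torus: "place ` boxes R K \<subseteq> torus"
  using M_pos unfolding place_def torus_def by (intro image_subsetI) (simp split: prod.split)

text \<open>An overlap yields a lattice point whose first \<open>d\<close> coordinates are
  differences of box points, hence the origin. Its last coordinate then shows that \<open>M\<close>
  divides \<open>(k - k') * b d\<close>, which the bound on \<open>K\<close> turns into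
  \<open>k = k'\<close>.\<close>

lemma inj_on_place:
  assumes R: "R \<subseteq> N" and K: "(int K - 1) * b d < M"
    and distinct: "\<And>r r'. r \<in> R \<Longrightarrow> r' \<in> R \<Longrightarrow> r - r' \<in> range comb \<Longrightarrow> r = r'"
  shows "inj_on place (boxes R K)"
proof (rule inj_onI)
  fix u u' assume u: "u \<in> boxes R K" "u' \<in> boxes R K" "place u = place u'"
  obtain r k c where ueq: "u = (r, k, c)" by (rule prod_cases3)
  obtain r' k' c' where ueq': "u' = (r', k', c')" by (rule prod_cases3)
  have mem: "(r, k, c) \<in> boxes R K" "(r', k', c') \<in> boxes R K"
    and eq: "place (r, k, c) = place (r', k', c')"
    using u by (simp_all add: ueq ueq')
  have rk: "r \<in> R" "r' \<in> R" "r \<in> N" "r' \<in> N" "k < K" "k' < K"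
    using mem R by (auto simp: boxes_def)
  have c: "c \<in> (\<Pi>\<^sub>E i\<in>{..<d}. {0..<b i})" "c' \<in> (\<Pi>\<^sub>E i\<in>{..<d}. {0..<b i})"
    using mem by (auto simp: boxes_def)
  define m where "m = int k - int k'"
  define p where "p i = ((l i r - l i r') + m * b i + (c i - c' i)) div M" for i
  have Mp: "M * p i = (l i r - l i r') + m * b i + (c i - c' i)" if "i < d" for i
  proof -
    have "(l i r + int k * b i + c i) mod M = (l i r' + int k' * b i + c' i) mod M"
      using fun_cong[OF eq, of i] that by (simp add: place_def)
    then have "M dvd (l i r - l i r') + m * b i + (c i - c' i)"
      by (simp add: mod_eq_dvd_iff m_def algebra_simps)
    then show ?thesis by (simp add: p_def)
  qed
  \<comment> \<open>The coefficient at \<open>d\<close> adjusts the sum to \<open>- m\<close>, so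
    that \<open>comb a\<close> supplies the shift \<open>m * b\<close> along with the multiples of
    \<open>M\<close>.\<close>
  define a where "a i = (if i < d then - p i else sum p {..<d} - m)" for i
  have sum_a: "sum a {..d} = - m"
    by (simp add: sum_atMost_last a_def sum_negf)
  define w where "w = (r - r') + comb a"
  have w: "w \<in> N" using rk by (simp add: w_def add_mem diff_mem comb_mem)
  have l_w: "l i w = - (c i - c' i)" if "i < d" for i
    using l_comb[of i a] Mp[OF that] that rk
    by (simp add: w_def l_add l_diff diff_mem comb_mem sum_a) (simp add: a_def)
  have "w = 0"
  proof (rule canonical_symmetric[OF w])
    fix i assume i: "i < d"
    then have "c i \<in> {0..<b i}" "c' i \<in> {0..<b i}" 
      using PiE_mem[OF c(1), of i] PiE_mem[OF c(2), of i] by simp_all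
    then show "\<bar>l i w\<bar> < b i" by (auto simp: l_w[OF i])
  qed
  have "c = c'"
    using c by (rule PiE_ext) (use l_w \<open>w = 0\<close> in auto)
  have "r - r' = comb (\<lambda>i. - a i)"
    using \<open>w = 0\<close> by (simp add: w_def comb_uminus[symmetric] eq_neg_iff_add_eq_0)
  then have "r = r'" using distinct rk by blast
  then have "comb a = 0" using \<open>w = 0\<close> by (simp add: w_def)
  then have "M * a d + m * b d = 0" using l_comb[of d a] by (simp add: sum_a)
  then have "m * b d = M * (- a d)" by simp
  then have "M dvd m * b d" by (rule dvdI)
  moreover have "\<bar>m * b d\<bar> < M"
  proof -
    have "\<bar>m * b d\<bar> \<le> (int K - 1) * b d"
      unfolding abs_mult using b_pos[of d] rk by (intro mult_mono) (auto simp: m_def)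
    with K show ?thesis by simp
  qed
  ultimately have "m * b d = 0" by (rule small_multiple_zero)
  then have "k = k'" using b_pos[of d] by (simp add: m_def)
  then show "u = u'" using \<open>r = r'\<close> \<open>c = c'\<close> by (simp add: ueq ueq')
qed

lemma packing_bound:
  assumes "R \<subseteq> N" "(int K - 1) * b d < M"
    and "\<And>r r'. r \<in> R \<Longrightarrow> r' \<in> R \<Longrightarrow> r - r' \<in> range comb \<Longrightarrow> r = r'"
  shows "int (card R * K) * prod b {..<d} \<le> M ^ d"
proof -
  have "card (boxes R K) \<le> card torus"
    by (rule card_inj_on_le[OF inj_on_place place_torus finite_torus]) (use assms in blast)+
  then have "int (card (boxes R K)) \<le> int (card torus)" by simp
  then show ?thesis unfolding card_boxes card_torus .
qed

text \<open>With an exact count the injective placement is onto, and the box covering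
  \<open>y\<close> modulo \<open>M\<close> is attached to the desired lattice point.\<close>

lemma tiling:
  assumes R: "R \<subseteq> N" "(int K - 1) * b d < M"
    "\<And>r r'. r \<in> R \<Longrightarrow> r' \<in> R \<Longrightarrow> r - r' \<in> range comb \<Longrightarrow> r = r'"
    and full: "int (card R * K) * prod b {..<d} = M ^ d"
  obtains x where "x \<in> N" "\<And>i. i < d \<Longrightarrow> y i - b i < l i x \<and> l i x \<le> y i"
proof -
  have inj: "inj_on place (boxes R K)" by (rule inj_on_place) (use R in blast)+
  have "int (card (boxes R K)) = int (card torus)"
    unfolding card_boxes card_torus by (rule full)
  then have "card (place ` boxes R K) = card torus" by (simp add: card_image[OF inj])
  then have "place ` boxes R K = torus"
    by (intro card_subset_eq finite_torus place_torus)
  moreover have "restrict (\<lambda>i. y i mod M) {..<d} \<in> torus"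
    using M_pos by (auto simp: torus_def)
  ultimately have "restrict (\<lambda>i. y i mod M) {..<d} \<in> place ` boxes R K" by simp
  then obtain u where u: "u \<in> boxes R K" "place u = restrict (\<lambda>i. y i mod M) {..<d}"
    by (rule imageE) simp
  obtain r k c where "u = (r, k, c)" by (rule prod_cases3)
  with u have mem: "(r, k, c) \<in> boxes R K"
    and eq: "place (r, k, c) = restrict (\<lambda>i. y i mod M) {..<d}" by simp_all
  have r: "r \<in> N" using mem R by (auto simp: boxes_def)
  define p where "p i = ((l i r + int k * b i + c i) - y i) div M" for i
  have Mp: "M * p i = (l i r + int k * b i + c i) - y i" if "i < d" for i
    using fun_cong[OF eq, of i] that by (simp add: place_def p_def mod_eq_dvd_iff)
  define a where "a i = (if i < d then - p i else sum p {..<d} - int k)" for i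
  have sum_a: "sum a {..d} = - int k"
    by (simp add: sum_atMost_last a_def sum_negf)
  have l_eq: "l i (r + comb a) = y i - c i" if "i < d" for i
    using l_comb[of i a] Mp[OF that] that r
    by (simp add: l_add comb_mem sum_a) (simp add: a_def)
  show ?thesis
  proof (rule that[of "r + comb a"])
    show "r + comb a \<in> N" using r by (simp add: add_mem comb_mem)
    fix i assume i: "i < d"
    moreover have "c \<in> (\<Pi>\<^sub>E i\<in>{..<d}. {0..<b i})" using mem by (simp add: boxes_def)
    ultimately have "c i \<in> {0..<b i}" by (intro PiE_mem[of c "{..<d}" _ i]) simp_all
    then show "y i - b i < l i (r + comb a) \<and> l i (r + comb a) \<le> y i"
      by (auto simp: l_eq[OF i])
  qed
qed

end

section \<open>The lattice of an extremal tiling\<close>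

locale extremal_tiling = integral_simplex +
  fixes m :: nat and h :: int
  assumes d_eq: "d = m + 2"
    and b_head: "i < m \<Longrightarrow> b i * int (sylvester (Suc i)) = M"
    and b_tail: "m \<le> i \<Longrightarrow> i \<le> d \<Longrightarrow> b i = h"
    and M_eq: "M = 3 * int (sylv_prod m) * h"
    and tile: "\<exists>x\<in>N. \<forall>i<d. y i - b i < l i x \<and> l i x \<le> y i"
begin

lemma h_pos: "h > 0"
  using b_pos[of m] b_tail[of m] d_eq by simp

lemma sum_split: "(\<Sum>i\<le>d. f i) = (\<Sum>i<m. f i) + f m + f (Suc m) + (f d :: int)"
  unfolding sum_atMost_last unfolding d_eq add_2_eq_Suc' sum.lessThan_Suc by simp

text \<open>The lattice point given by \<open>tile\<close> has nonpositive coordinates except for one, which is at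
  most \<open>h\<close>. It lies outside the interior only if its last coordinate is at most \<open>- h\<close>, and since
  the coordinates sum to \<open>0\<close> this forces equality everywhere.\<close>

lemma edge_mem:
  assumes j: "j = m \<or> j = Suc m"
  obtains x where "x \<in> N" "\<And>i. i < d \<Longrightarrow> l i x = (if i = j then h else 0)" "l d x = - h"
proof -
  define y where "y i = (if i = j then h else 0)" for i
  obtain x where x: "x \<in> N" "\<And>i. i < d \<Longrightarrow> y i - b i < l i x \<and> l i x \<le> y i"
    using tile[of y] by blast
  have jd: "j < d" using j d_eq by auto
  have bj: "b j = h" using b_tail j d_eq by auto
  have upper: "l i x \<le> y i" if "i < d" for i using x(2)[OF that] by simp
  have last: "l d x \<le> - h"
  proof (rule ccontr)
    assume "\<not> l d x \<le> - h"
    then have "x = 0"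
    proof (intro canonical[OF x(1)])
      fix i assume "i \<le> d"
      then show "- b i < l i x"
        using x(2)[of i] \<open>\<not> l d x \<le> - h\<close> b_tail[of d] d_eq h_pos
        by (cases "i = d") (auto simp: y_def split: if_splits)
    qed
    then show False using x(2)[OF jd] bj by (simp add: y_def)
  qed
  have "(\<Sum>i<d. y i) = h" using jd by (simp add: y_def)
  moreover have "(\<Sum>i<d. l i x) = - l d x"
    using l_sum[OF x(1)] by (simp add: sum_atMost_last)
  moreover have le: "(\<Sum>i<d. l i x) \<le> (\<Sum>i<d. y i)" by (intro sum_mono upper) auto
  ultimately have "l d x = - h" and s: "(\<Sum>i<d. y i - l i x) = 0"
    using last by (auto simp: sum_subtractf)
  have "y i - l i x = 0" if "i < d" for i
    using s that upper by (subst (asm) sum_nonneg_eq_0_iff) auto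
  then show ?thesis using that[of x] x(1) \<open>l d x = - h\<close> by (auto simp: y_def)
qed

text \<open>The vertices and the two points from \<open>edge_mem\<close> have this divisibility, and
  they generate \<open>N\<close>: adding suitable combinations brings the first \<open>d\<close>
  coordinates into the windows from \<open>- b i\<close> (excluded) to 0. The last coordinate is
  then nonnegative by \<open>l_sum\<close>, and canonicity leaves only the origin.\<close>

lemma b_dvd_l:
  assumes x: "x \<in> N" and i: "i \<le> d"
  shows "b i dvd l i x"
proof -
  obtain cr :: "nat \<Rightarrow> int" where cr: "\<And>i j. i < m \<Longrightarrow> j < m \<Longrightarrow>
      [cr i = (if i = j then 1 else 0)] (mod int (sylvester (Suc j)))"
    using sylvester_crt[of m] by metis
  obtain f where f: "f \<in> N" "\<And>i. i < d \<Longrightarrow> l i f = (if i = m then h else 0)" "l d f = - h"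
    using edge_mem[of m] by auto
  obtain g where g: "g \<in> N" "\<And>i. i < d \<Longrightarrow> l i g = (if i = Suc m then h else 0)" "l d g = - h"
    using edge_mem[of "Suc m"] by auto
  define q where "q i = - l i x div b i" for i
  \<comment> \<open>A single multiple of \<open>b\<close> has to correct all head coordinates at
    once. \<open>k\<close> has the residue \<open>q j\<close> modulo each Sylvester number, and the
    error is a multiple of \<open>M\<close> in coordinate \<open>j\<close>, absorbed by
    \<open>a\<close>.\<close>
  define k where "k = (\<Sum>i<m. q i * cr i)"
  have k: "int (sylvester (Suc j)) dvd k - q j" if "j < m" for j
  proof -
    have "[k = (\<Sum>i<m. q i * (if i = j then 1 else 0))] (mod int (sylvester (Suc j)))"
      unfolding k_def by (intro cong_sum cong_mult cong_refl cr) (use that in auto)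
    also have "(\<Sum>i<m. q i * (if i = j then 1 else 0)) = q j"
      using that by (simp add: if_distrib cong: if_cong)
    finally have "[k = q j] (mod int (sylvester (Suc j)))" .
    then show ?thesis by (simp add: cong_iff_dvd_diff)
  qed
  \<comment> \<open>Indices \<open>m\<close> and \<open>Suc m\<close> keep coefficient 0, as
    \<open>f\<close> and \<open>g\<close> correct those coordinates; index \<open>d\<close> makes
    the sum \<open>- k\<close>.\<close>
  define a where "a i = (if i < m then - ((k - q i) div int (sylvester (Suc i)))
    else if i = d then - k - (\<Sum>i<m. - ((k - q i) div int (sylvester (Suc i)))) else 0)" for i
  have sum_a: "sum a {..d} = - k"
    unfolding sum_split by (simp add: a_def d_eq)
  have Ma: "M * a i = - ((k - q i) * b i)" if "i < m" for i
  proof -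
    have "M * a i = - (b i * (int (sylvester (Suc i)) * ((k - q i) div int (sylvester (Suc i)))))"
      using that b_head[OF that] by (simp add: a_def)
    also have "int (sylvester (Suc i)) * ((k - q i) div int (sylvester (Suc i))) = k - q i"
      using k[OF that] by simp
    finally show ?thesis by (simp add: mult.commute)
  qed
  define x' where "x' = x + comb a"
  have x': "x' \<in> N" using x by (simp add: x'_def add_mem comb_mem)
  have l_x': "l i x' = l i x + M * a i + k * b i" if "i \<le> d" for i
    using l_comb[OF that, of a] x by (simp add: x'_def l_add comb_mem sum_a)
  have head: "l i x' = l i x + q i * b i" if "i < m" for i
    using l_x'[of i] Ma[OF that] that d_eq by (simp add: algebra_simps)
  define s where "s = - l m x' div h"
  define t where "t = - l (Suc m) x' div h"
  define z where "z = x' + (of_int s *\<^sub>R f + of_int t *\<^sub>R g)"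
  have z: "z \<in> N" using x' f(1) g(1) by (simp add: z_def add_mem scale_mem)
  have l_z: "l i z = l i x' + (s * l i f + t * l i g)" for i
    using x' f(1) g(1) by (simp add: z_def add_mem scale_mem l_add l_scale)
  have window: "- c < e + (- e div c) * c \<and> e + (- e div c) * c \<le> 0" if "c > 0" for c e :: int
  proof -
    have "- e = (- e div c) * c + (- e) mod c" by simp
    moreover have "0 \<le> (- e) mod c" "(- e) mod c < c" using that by auto
    ultimately show ?thesis by linarith
  qed
  have low: "- b i < l i z \<and> l i z \<le> 0" if id: "i < d" for i
  proof -
    consider "i < m" | "i = m" | "i = Suc m" using id d_eq by linarith
    then show ?thesis
    proof cases
      case 1
      then show ?thesis using window[of "b i" "l i x"] b_pos[of i] id f(2) g(2)
        by (simp add: l_z head q_def)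
    next
      case 2
      then show ?thesis using window[of h "l m x'"] h_pos id f(2) g(2) b_tail[of m]
        by (simp add: l_z s_def)
    next
      case 3
      then show ?thesis using window[of h "l (Suc m) x'"] h_pos id f(2) g(2) b_tail[of "Suc m"]
        by (simp add: l_z t_def)
    qed
  qed
  have "z = 0"
  proof (rule canonical[OF z])
    fix i assume "i \<le> d"
    have "(\<Sum>i<d. l i z) \<le> 0" using low by (intro sum_nonpos) auto
    then have "l d z \<ge> 0"
      using l_sum[OF z] by (simp add: sum_atMost_last)
    then show "- b i < l i z" using low[of i] \<open>i \<le> d\<close> b_pos[of d] by (cases "i = d") auto
  qed
  then have l_x: "l i x = - (M * a i + k * b i + (s * l i f + t * l i g))"
    using l_z[of i] l_x'[OF i] by simp
  have "b i dvd M"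
  proof (cases "i < m")
    case True
    then show ?thesis using b_head[of i] by (metis dvd_triv_left)
  next
    case False
    then show ?thesis using b_tail[of i] i M_eq by simp
  qed
  moreover have "b i dvd l i f \<and> b i dvd l i g"
  proof (cases "i < m")
    case True
    then show ?thesis using f(2)[of i] g(2)[of i] d_eq by simp
  next
    case False
    then show ?thesis using f g b_tail[of i] i by (cases "i = d") auto
  qed
  ultimately show ?thesis unfolding l_x by (auto intro: dvd_add dvd_mult dvd_mult2)
qed

text \<open>The half-open window given by \<open>tile\<close> contains exactly one multiple of
  \<open>b i\<close>, namely \<open>c i * b i\<close>.\<close>

lemma coordinates_onto:
  obtains x where "x \<in> N" "\<And>i. i < d \<Longrightarrow> l i x = c i * b i"
proof -
  obtain x where x: "x \<in> N" "\<And>i. i < d \<Longrightarrow> c i * b i - b i < l i x \<and> l i x \<le> c i * b i"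
    using tile[of "\<lambda>i. c i * b i"] by blast
  have "l i x = c i * b i" if "i < d" for i
  proof -
    have "b i dvd c i * b i - l i x" using b_dvd_l[OF x(1), of i] that by simp
    moreover have "\<bar>c i * b i - l i x\<bar> < b i" using x(2)[OF that] by auto
    ultimately have "c i * b i - l i x = 0" by (rule small_multiple_zero)
    then show ?thesis by simp
  qed
  then show ?thesis using that x(1) by blast
qed

end

section \<open>Coordinates of a canonical simplex\<close>

lemma basis_coordinates:
  fixes f :: "'i \<Rightarrow> 'a::euclidean_space"
  assumes "finite I" "inj_on f I" "independent (f ` I)" "card I = DIM('a)"
  obtains X :: "'i \<Rightarrow> 'a \<Rightarrow> real"
  where "\<And>i. linear (X i)" "\<And>x. (\<Sum>i\<in>I. X i x *\<^sub>R f i) = x"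
    "\<And>i c. i \<in> I \<Longrightarrow> X i (\<Sum>j\<in>I. c j *\<^sub>R f j) = c i"
proof -
  define X where "X i x = representation (f ` I) x (f i)" for i x
  have span: "x \<in> span (f ` I)" for x
    using card_eq_dim[of "f ` I" UNIV] assms by (auto simp: card_image)
  have lin: "linear (X i)" for i
    unfolding X_def using assms(3) span
    by (intro linearI) (simp_all add: representation_add representation_scale)
  have sum: "(\<Sum>i\<in>I. X i x *\<^sub>R f i) = x" for x
    using sum_representation_eq[OF assms(3) span _ subset_refl, of x] assms
    by (simp add: sum.reindex X_def)
  have "X i (\<Sum>j\<in>I. c j *\<^sub>R f j) = c i" if i: "i \<in> I" for i c
  proof -
    have "X i (f j) = (if j = i then 1 else 0)" if "j \<in> I" for j
      using assms that i by (auto simp: X_def representation_basis inj_on_eq_iff)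
    then have "(\<Sum>j\<in>I. c j * X i (f j)) = (\<Sum>j\<in>I. if j = i then c j else 0)"
      by (intro sum.cong) auto
    also have "\<dots> = c i" using assms i by simp
    finally show ?thesis by (simp add: linear_sum[OF lin] linear_cmul[OF lin])
  qed
  with lin sum that show ?thesis by blast
qed

lemma finite_lattice_bounded:
  fixes e :: "nat \<Rightarrow> 'a::euclidean_space"
  assumes "d = DIM('a)" "inj_on e {1..d}" "independent (e ` {1..d})"
  shows "finite {x \<in> int_span (e ` {1..d}). norm x \<le> C}"
proof -
  obtain X where X: "\<And>i. linear (X i)" "\<And>x. (\<Sum>i\<in>{1..d}. X i x *\<^sub>R e i) = x"
    "\<And>i c. i \<in> {1..d} \<Longrightarrow> X i (\<Sum>j\<in>{1..d}. c j *\<^sub>R e j) = c i"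
    using basis_coordinates[of "{1..d}" e] assms by auto
  have "\<forall>i. \<exists>B>0. \<forall>x. norm (X i x) \<le> B * norm x"
    using linear_bounded_pos[OF X(1)] by metis
  then obtain B where B: "\<And>i. B i > 0" "\<And>i x. norm (X i x) \<le> B i * norm x" by metis
  define D where "D i = \<lfloor>B i * C\<rfloor> + 1" for i
  define F where "F x = restrict (\<lambda>i. \<lfloor>X i x\<rfloor>) {1..d}" for x
  let ?S = "{x \<in> int_span (e ` {1..d}). norm x \<le> C}"
  have "F ` ?S \<subseteq> (\<Pi>\<^sub>E i\<in>{1..d}. {- D i..D i})"
  proof (rule image_subsetI)
    fix x assume x: "x \<in> ?S"
    have "- D i \<le> \<lfloor>X i x\<rfloor> \<and> \<lfloor>X i x\<rfloor> \<le> D i" for i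
    proof -
      have "\<bar>X i x\<bar> \<le> B i * norm x" using B(2)[of i x] by simp
      also have "\<dots> \<le> B i * C" using x B(1)[of i] by (intro mult_left_mono) auto
      finally show ?thesis unfolding D_def by linarith
    qed
    then show "F x \<in> (\<Pi>\<^sub>E i\<in>{1..d}. {- D i..D i})" by (auto simp: F_def)
  qed
  then have "finite (F ` ?S)" by (rule finite_subset) (auto intro: finite_PiE)
  moreover have "inj_on F ?S"
  proof (rule inj_onI)
    fix x y assume x: "x \<in> ?S" and y: "y \<in> ?S" and eq: "F x = F y"
    have rep: "x = (\<Sum>i\<in>{1..d}. of_int \<lfloor>X i x\<rfloor> *\<^sub>R e i)" if "x \<in> ?S" for x
    proof -
      obtain c where c: "x = (\<Sum>i\<in>{1..d}. of_int (c i) *\<^sub>R e i)"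
        using \<open>x \<in> ?S\<close> int_span_image[OF assms(2)] by auto
      have "\<lfloor>X i x\<rfloor> = c i" if "i \<in> {1..d}" for i
        unfolding c X(3)[OF that] by simp
      then show ?thesis using c by simp
    qed
    have "\<lfloor>X i x\<rfloor> = \<lfloor>X i y\<rfloor>" if "i \<in> {1..d}" for i
      using fun_cong[OF eq, of i] that by (simp add: F_def)
    then show "x = y" using rep[OF x] rep[OF y] by simp
  qed
  ultimately show ?thesis by (rule finite_imageD)
qed

locale coordinatized_simplex =
  fixes e :: "nat \<Rightarrow> 'a::euclidean_space" and d :: nat and N P :: "'a set"
    and v :: "nat \<Rightarrow> 'a" and \<beta> :: "nat \<Rightarrow> real"
  assumes d_eq: "d = DIM('a)" and d_ge: "d \<ge> 5"
    and e_inj: "inj_on e {1..d}" and e_indep: "independent (e ` {1..d})"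
    and N_eq: "N = int_span (e ` {1..d})"
    and v_inj: "inj_on v {..d}" and v_indep: "\<not> affine_dependent (v ` {..d})"
    and P_eq: "P = convex hull (v ` {..d})" and v_mem: "i \<le> d \<Longrightarrow> v i \<in> N"
    and interior: "interior P \<inter> N = {0}"
    and \<beta>_pos: "i \<le> d \<Longrightarrow> 0 < \<beta> i" and \<beta>_anti: "i \<le> j \<Longrightarrow> j \<le> d \<Longrightarrow> \<beta> j \<le> \<beta> i"
    and \<beta>_sum: "sum \<beta> {..d} = 1" and \<beta>_v: "(\<Sum>i\<le>d. \<beta> i *\<^sub>R v i) = 0"

text \<open>Indexed weights permit two enumerations of the same vertices: by decreasing weight of
  the origin, and by the corners of the extremal simplex.\<close>

lemma interior_simplex_indexed:
  fixes v :: "nat \<Rightarrow> 'a::euclidean_space"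
  assumes "d = DIM('a)" "inj_on v {..d}" "\<not> affine_dependent (v ` {..d})"
  shows "x \<in> interior (convex hull (v ` {..d})) \<longleftrightarrow>
    (\<exists>\<gamma>. (\<forall>i\<le>d. 0 < \<gamma> i) \<and> sum \<gamma> {..d} = 1 \<and> (\<Sum>i\<le>d. \<gamma> i *\<^sub>R v i) = x)"
proof -
  have "card (v ` {..d}) = Suc d" using assms by (simp add: card_image)
  then have int: "interior (convex hull (v ` {..d})) = {y. \<exists>u. (\<forall>x\<in>v ` {..d}. 0 < u x) \<and>
      sum u (v ` {..d}) = 1 \<and> (\<Sum>x\<in>v ` {..d}. u x *\<^sub>R x) = y}"
    using interior_convex_hull_explicit_minimal[OF assms(3)] assms(1) by simp
  show ?thesis
  proof
    assume "x \<in> interior (convex hull (v ` {..d}))"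
    then obtain u where "\<forall>x\<in>v ` {..d}. 0 < u x" "sum u (v ` {..d}) = 1"
      "(\<Sum>x\<in>v ` {..d}. u x *\<^sub>R x) = x" unfolding int by auto
    then show "\<exists>\<gamma>. (\<forall>i\<le>d. 0 < \<gamma> i) \<and> sum \<gamma> {..d} = 1 \<and> (\<Sum>i\<le>d. \<gamma> i *\<^sub>R v i) = x"
      by (intro exI[of _ "\<lambda>i. u (v i)"]) (simp add: sum.reindex[OF assms(2)])
  next
    assume "\<exists>\<gamma>. (\<forall>i\<le>d. 0 < \<gamma> i) \<and> sum \<gamma> {..d} = 1 \<and> (\<Sum>i\<le>d. \<gamma> i *\<^sub>R v i) = x"
    then obtain \<gamma> where \<gamma>: "\<forall>i\<le>d. 0 < \<gamma> i" "sum \<gamma> {..d} = 1" "(\<Sum>i\<le>d. \<gamma> i *\<^sub>R v i) = x" by auto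
    then show "x \<in> interior (convex hull (v ` {..d}))"
      unfolding int using assms(2)
      by (intro CollectI exI[of _ "\<lambda>y. \<gamma> (inv_into {..d} v y)"])
        (auto simp: sum.reindex[OF assms(2)])
  qed
qed

lemma sorted_enumeration:
  fixes u :: "'b \<Rightarrow> 'c::linorder"
  assumes "finite C" "card C = Suc d"
  obtains v where "inj_on v {..d}" "C = v ` {..d}" "\<And>i j. i \<le> j \<Longrightarrow> j \<le> d \<Longrightarrow> u (v j) \<le> u (v i)"
proof -
  obtain xs where xs: "set xs = C" "distinct xs"
    using finite_distinct_list[OF assms(1)] by auto
  define ys where "ys = rev (sort_key u xs)"
  have ys: "set ys = C" "distinct ys" "length ys = Suc d"
    using xs assms(2) by (auto simp: ys_def distinct_card[symmetric])
  have desc: "u (ys ! j) \<le> u (ys ! i)" if "i \<le> j" "j \<le> d" for i j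
  proof -
    have "sorted (map u (rev ys))" by (simp add: ys_def)
    then have "map u (rev ys) ! (d - j) \<le> map u (rev ys) ! (d - i)"
      using that ys(3) by (intro sorted_nth_mono) auto
    moreover have "map u (rev ys) ! (d - k) = u (ys ! k)" if "k \<le> d" for k
      using that ys(3) by (simp add: rev_nth)
    ultimately show ?thesis using that by simp
  qed
  show ?thesis
  proof (rule that[of "\<lambda>i. ys ! i"])
    show "inj_on ((!) ys) {..d}" using ys by (auto simp: inj_on_def nth_eq_iff_index_eq)
    have "{..d} = {..<length ys}" using ys(3) by auto
    then show "C = (!) ys ` {..d}" using ys(1) by (auto simp: set_conv_nth)
  qed (rule desc)
qed

lemma canonical_coordinatized:
  fixes e :: "nat \<Rightarrow> 'a::euclidean_space"
  assumes "d = DIM('a)" "d \<ge> 5" "inj_on e {1..d}" "independent (e ` {1..d})"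
    "N = int_span (e ` {1..d})" "canonical_lattice_simplex N P"
  obtains v \<beta> where "coordinatized_simplex e d N P v \<beta>"
proof -
  obtain C where C: "\<not> affine_dependent C" "card C = Suc d" "P = convex hull C"
    using assms(1,6) unfolding canonical_lattice_simplex_def simplex_def by auto
  have vert: "vertices P = C"
    unfolding vertices_def C(3) using C(1) by (auto simp: extreme_point_of_convex_hull_affine_independent)
  have "finite C" using C(2) by (metis card.infinite nat.distinct(1))
  have "0 \<in> interior (convex hull C)"
    using assms(6) C(3) by (auto simp: canonical_lattice_simplex_def)
  then obtain u where u: "\<forall>x\<in>C. 0 < u x" "sum u C = 1" "(\<Sum>x\<in>C. u x *\<^sub>R x) = 0"
    unfolding interior_convex_hull_explicit_minimal[OF C(1)] using C(2) assms(1) by auto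
  obtain v where v: "inj_on v {..d}" "C = v ` {..d}"
    "\<And>i j. i \<le> j \<Longrightarrow> j \<le> d \<Longrightarrow> u (v j) \<le> u (v i)"
    using sorted_enumeration[OF \<open>finite C\<close> C(2), of u] by blast
  have "coordinatized_simplex e d N P v (\<lambda>i. u (v i))"
  proof
    show "sum (\<lambda>i. u (v i)) {..d} = 1" "(\<Sum>i\<le>d. u (v i) *\<^sub>R v i) = 0"
      using u unfolding v(2) sum.reindex[OF v(1)] by auto
  qed (use assms C v u vert in \<open>auto simp: canonical_lattice_simplex_def\<close>)
  then show ?thesis by (rule that)
qed

context coordinatized_simplex
begin

lemma vertices_P: "vertices P = v ` {..d}"
  unfolding vertices_def P_eq
  using v_indep by (auto simp: extreme_point_of_convex_hull_affine_independent)

lemma N_mem_iff: "x \<in> N \<longleftrightarrow> (\<exists>c. x = (\<Sum>i\<in>{1..d}. of_int (c i) *\<^sub>R e i))"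
  unfolding N_eq int_span_image[OF e_inj finite_atLeastAtMost] by auto

lemma e_mem: "i \<in> {1..d} \<Longrightarrow> e i \<in> N"
  unfolding N_eq int_span_def by (intro CollectI exI[of _ "{e i}"] exI[of _ "\<lambda>_. 1"]) simp

lemma N_diff: "x \<in> N \<Longrightarrow> y \<in> N \<Longrightarrow> x - y \<in> N"
  unfolding N_mem_iff
proof safe
  fix a b :: "nat \<Rightarrow> int"
  show "\<exists>c. (\<Sum>i\<in>{1..d}. of_int (a i) *\<^sub>R e i) - (\<Sum>i\<in>{1..d}. of_int (b i) *\<^sub>R e i) =
      (\<Sum>i\<in>{1..d}. of_int (c i) *\<^sub>R e i)"
    by (intro exI[of _ "\<lambda>i. a i - b i"]) (simp add: sum_subtractf scaleR_left_diff_distrib)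
qed

lemma N_scale: "x \<in> N \<Longrightarrow> of_int k *\<^sub>R x \<in> N"
  unfolding N_mem_iff
proof safe
  fix a :: "nat \<Rightarrow> int"
  show "\<exists>c. of_int k *\<^sub>R (\<Sum>i\<in>{1..d}. of_int (a i) *\<^sub>R e i) = (\<Sum>i\<in>{1..d}. of_int (c i) *\<^sub>R e i)"
    by (intro exI[of _ "\<lambda>i. k * a i"]) (simp add: scaleR_sum_right)
qed

lemma N_sum: "finite I \<Longrightarrow> (\<And>i. i \<in> I \<Longrightarrow> f i \<in> N) \<Longrightarrow> sum f I \<in> N"
proof (induction I rule: finite_induct)
  case empty
  then show ?case using N_diff[OF v_mem v_mem, of 0 0] by simp
next
  case (insert i I)
  then have "f i \<in> N" "of_int (- 1) *\<^sub>R sum f I \<in> N" by (auto intro!: N_scale simp del: of_int_minus)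
  then show ?case using insert N_diff[of "f i" "of_int (- 1) *\<^sub>R sum f I"] by simp
qed

text \<open>\<open>L i x\<close> is the change of the \<open>i\<close>-th barycentric coordinate
  under translation by \<open>x\<close>. Unlike the barycentric coordinate
  \<open>L i x + \<beta> i\<close> it is linear.\<close>

lemma difference_coordinates:
  obtains L :: "nat \<Rightarrow> 'a \<Rightarrow> real"
  where "\<And>i. linear (L i)" "\<And>x. (\<Sum>i\<le>d. L i x) = 0" "\<And>x. (\<Sum>i\<le>d. L i x *\<^sub>R v i) = x"
    "\<And>c i. sum c {..d} = 0 \<Longrightarrow> i \<le> d \<Longrightarrow> L i (\<Sum>i\<le>d. c i *\<^sub>R v i) = c i"
proof -
  define f where "f i = v i - v d" for i
  have "v ` {..d} - {v d} = v ` {..<d}"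
  proof -
    have "{..<d} = {..d} - {d}" by auto
    then show ?thesis using inj_on_image_set_diff[OF v_inj, of "{..d}" "{d}"] by simp
  qed
  then have "(\<lambda>x. - v d + x) ` (v ` {..d} - {v d}) = f ` {..<d}"
    by (auto simp: f_def image_image)
  then have "independent (f ` {..<d})"
    using affine_dependent_iff_dependent2[of "v d" "v ` {..d}"] v_indep by auto
  moreover have "inj_on f {..<d}" using v_inj by (auto simp: f_def inj_on_def)
  ultimately obtain X where X: "\<And>i. linear (X i)" "\<And>x. (\<Sum>i<d. X i x *\<^sub>R f i) = x"
    "\<And>i c. i < d \<Longrightarrow> X i (\<Sum>j<d. c j *\<^sub>R f j) = c i"
    using basis_coordinates[of "{..<d}" f] d_eq by auto
  define L where "L i x = (if i < d then X i x else - (\<Sum>i<d. X i x))" for i x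
  have expand: "(\<Sum>i\<le>d. c i *\<^sub>R v i) = (\<Sum>i<d. c i *\<^sub>R f i)" if "sum c {..d} = 0" for c
  proof -
    have "c d = - sum c {..<d}" using that unfolding sum_atMost_last by simp
    then show ?thesis
      unfolding sum_atMost_last f_def by (simp add: scaleR_right_diff_distrib sum_subtractf scaleR_sum_left)
  qed
  show ?thesis
  proof (rule that[of L])
    show "linear (L i)" for i
      using X(1) unfolding L_def by (cases "i < d") (auto intro!: linear_compose_sum linear_compose_neg)
    show s: "(\<Sum>i\<le>d. L i x) = 0" for x unfolding sum_atMost_last by (simp add: L_def)
    show "(\<Sum>i\<le>d. L i x *\<^sub>R v i) = x" for x
      using X(2)[of x] by (simp add: expand[OF s]) (simp add: L_def)
    show "L i (\<Sum>i\<le>d. c i *\<^sub>R v i) = c i" if "sum c {..d} = 0" "i \<le> d" for c i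
    proof (cases "i < d")
      case True
      then show ?thesis by (simp add: expand[OF that(1)] L_def X(3))
    next
      case False
      have "c d = - sum c {..<d}" using that unfolding sum_atMost_last by simp
      then show ?thesis using False that(2) by (simp add: expand[OF that(1)] L_def X(3))
    qed
  qed
qed

text \<open>Two multiples of \<open>x\<close> agree after reduction into the half-open parallelepiped spanned by
  the edges, because it contains only finitely many lattice points.\<close>

lemma common_denominator:
  assumes L: "\<And>i. linear (L i)" "\<And>x. (\<Sum>i\<le>d. L i x) = 0" "\<And>x. (\<Sum>i\<le>d. L i x *\<^sub>R v i) = x"
    "\<And>c i. sum c {..d} = 0 \<Longrightarrow> i \<le> d \<Longrightarrow> L i (\<Sum>i\<le>d. c i *\<^sub>R v i) = c i"
  obtains M :: int where "M > 0" "\<And>x i. x \<in> N \<Longrightarrow> i \<le> d \<Longrightarrow> of_int M * L i x \<in> \<int>"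
proof -
  have "\<exists>m>0. \<forall>i\<le>d. of_int m * L i x \<in> \<int>" if x: "x \<in> N" for x
  proof -
    define c where "c k i = (if i < d then frac (real k * L i x) else - (\<Sum>i<d. frac (real k * L i x)))"
      for k :: nat and i
    define F where "F k = (\<Sum>i\<le>d. c k i *\<^sub>R v i)" for k
    have c_sum: "sum (c k) {..d} = 0" for k unfolding sum_atMost_last by (simp add: c_def)
    have F_eq: "F k = of_int (int k) *\<^sub>R x - (\<Sum>i<d. of_int \<lfloor>real k * L i x\<rfloor> *\<^sub>R (v i - v d))" for k
    proof -
      have edges: "(\<Sum>i\<le>d. a i *\<^sub>R v i) = (\<Sum>i<d. a i *\<^sub>R (v i - v d))" if "sum a {..d} = 0" for a
      proof -
        have "a d = - sum a {..<d}" using that unfolding sum_atMost_last by simp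
        then show ?thesis
          unfolding sum_atMost_last by (simp add: scaleR_right_diff_distrib sum_subtractf scaleR_sum_left)
      qed
      have "of_int (int k) *\<^sub>R x = of_int (int k) *\<^sub>R (\<Sum>i<d. L i x *\<^sub>R (v i - v d))"
        using edges[of "\<lambda>i. L i x", OF L(2)] L(3)[of x] by simp
      then show ?thesis
        unfolding F_def edges[OF c_sum]
        by (simp add: c_def frac_def scaleR_sum_right scaleR_left_diff_distrib sum_subtractf)
    qed
    have F_mem: "F k \<in> N" for k
      unfolding F_eq by (intro N_diff N_scale x N_sum v_mem) auto
    have F_norm: "norm (F k) \<le> (\<Sum>i<d. norm (v i)) + real d * norm (v d)" for k
    proof -
      have c1: "\<bar>c k i\<bar> \<le> 1" if "i < d" for i
        using that frac_lt_1[of "real k * L i x"] frac_ge_0[of "real k * L i x"] by (simp add: c_def)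
      have "norm (F k) \<le> (\<Sum>i<d. norm (c k i *\<^sub>R v i)) + norm (c k d *\<^sub>R v d)"
        unfolding F_def sum_atMost_last by (intro order_trans[OF norm_triangle_ineq] add_right_mono norm_sum)
      also have "\<dots> \<le> (\<Sum>i<d. norm (v i)) + real d * norm (v d)"
      proof (intro add_mono sum_mono)
        show "norm (c k i *\<^sub>R v i) \<le> norm (v i)" if "i \<in> {..<d}" for i
          using c1[of i] that by (simp add: mult_left_le_one_le)
        have "\<bar>c k d\<bar> \<le> (\<Sum>i<d. \<bar>c k i\<bar>)"
        proof -
          have "c k d = - (\<Sum>i<d. c k i)" using c_sum[of k] unfolding sum_atMost_last by simp
          then show ?thesis by (simp add: sum_abs)
        qed
        also have "\<dots> \<le> (\<Sum>i<d. 1)" using c1 by (intro sum_mono) auto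
        finally show "norm (c k d *\<^sub>R v d) \<le> real d * norm (v d)"
          by (simp add: mult_right_mono)
      qed
      finally show ?thesis .
    qed
    have "range F \<subseteq>
        {x \<in> int_span (e ` {1..d}). norm x \<le> (\<Sum>i<d. norm (v i)) + real d * norm (v d)}"
      using F_mem[unfolded N_eq] F_norm by (intro image_subsetI CollectI conjI)
    then have "finite (range F)"
      by (rule finite_subset) (rule finite_lattice_bounded[OF d_eq e_inj e_indep])
    then have "\<not> inj F" by (metis finite_imageD infinite_UNIV_nat)
    then obtain j j' where "F j = F j'" "j \<noteq> j'" unfolding inj_def by metis
    then obtain k k' where k: "k < k'" "F k = F k'" by (metis linorder_neqE_nat)
    have "of_int (int k' - int k) * L i x \<in> \<int>" if "i < d" for i
    proof -
      have "c k i = c k' i"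
        using L(4)[OF c_sum, of i k] L(4)[OF c_sum, of i k'] k(2) that by (simp add: F_def)
      then have "real k' * L i x - real k * L i x = of_int (\<lfloor>real k' * L i x\<rfloor> - \<lfloor>real k * L i x\<rfloor>)"
        using that by (simp add: c_def frac_def)
      then show ?thesis by (simp add: left_diff_distrib)
    qed
    moreover have "of_int (int k' - int k) * L d x = - (\<Sum>i<d. of_int (int k' - int k) * L i x)"
    proof -
      have "L d x = - (\<Sum>i<d. L i x)" using L(2)[of x] unfolding sum_atMost_last by simp
      then show ?thesis by (simp add: sum_distrib_left)
    qed
    ultimately have "of_int (int k' - int k) * L i x \<in> \<int>" if "i \<le> d" for i
      using that by (cases "i = d") (auto intro!: Ints_minus Ints_sum)
    then show ?thesis using k(1) by (intro exI[of _ "int k' - int k"]) auto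
  qed
  then have "\<forall>j\<in>{1..d}. \<exists>m>0. \<forall>i\<le>d. of_int m * L i (e j) \<in> \<int>" using e_mem by blast
  then obtain m where m: "\<And>j. j \<in> {1..d} \<Longrightarrow> m j > (0::int)"
    "\<And>i j. j \<in> {1..d} \<Longrightarrow> i \<le> d \<Longrightarrow> of_int (m j) * L i (e j) \<in> \<int>" by metis
  define M where "M = prod m {1..d}"
  have "of_int M * L i x \<in> \<int>" if "x \<in> N" "i \<le> d" for x i
  proof -
    obtain c where c: "x = (\<Sum>j\<in>{1..d}. of_int (c j) *\<^sub>R e j)" using \<open>x \<in> N\<close> N_mem_iff by auto
    have "of_int M * L i x = (\<Sum>j\<in>{1..d}. of_int (c j) * (of_int M * L i (e j)))"
      unfolding c by (simp add: linear_sum[OF L(1)] linear_cmul[OF L(1)] sum_distrib_left mult_ac)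
    moreover have "of_int M * L i (e j) \<in> \<int>" if "j \<in> {1..d}" for j
    proof -
      have "M = prod m ({1..d} - {j}) * m j"
        unfolding M_def using that by (simp add: prod.remove mult.commute)
      then have "of_int M * L i (e j) = of_int (prod m ({1..d} - {j})) * (of_int (m j) * L i (e j))"
        by (simp only: of_int_mult mult.assoc)
      then show ?thesis by (simp only: Ints_mult Ints_of_int m(2)[OF that \<open>i \<le> d\<close>])
    qed
    ultimately show ?thesis by (auto intro!: Ints_sum)
  qed
  moreover have "M > 0" unfolding M_def using m(1) by (intro prod_pos) auto
  ultimately show ?thesis using that by blast
qed

end

section \<open>The extremal simplex and its multiplicity\<close>

text \<open>The reciprocals of the extremal barycentric coordinates. For \<open>i < d\<close> they
  are the lengths along the axes; at \<open>i = d\<close> the value is the reciprocal weight of the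
  corner without an axis.\<close>

definition side :: "nat \<Rightarrow> nat \<Rightarrow> int" where
  "side d i = (if i < d - 2 then int (sylvester (Suc i)) else 3 * int (sylv_prod (d - 2)))"

text \<open>The vertex \<open>0\<close> of the extremal simplex before its translation corresponds to index
  \<open>d\<close>.\<close>

definition corner :: "(nat \<Rightarrow> 'a::real_vector) \<Rightarrow> nat \<Rightarrow> nat \<Rightarrow> 'a" where
  "corner e d i = (if i < d then of_int (side d i) *\<^sub>R e (Suc i) else 0) - (\<Sum>j = 1..d. e j)"

lemma side_pos: "side d i > 0"
  by (simp add: side_def sylvester_Suc)

lemma extremal_simplex_eq:
  assumes "d \<ge> 2"
  shows "extremal_simplex d e = convex hull (corner e d ` {..d})"
proof -
  define c where "c = (\<Sum>j = 1..d. e j)"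
  define S where "S = {0} \<union> {real (sylvester i) *\<^sub>R e i |i. i \<in> {1..d - 2}} \<union>
           {(3 * (real (sylvester (d - 1)) - 1)) *\<^sub>R e (d - 1),
            (3 * (real (sylvester (d - 1)) - 1)) *\<^sub>R e d}"
  have d1: "d - 1 = Suc (d - 2)" "d = Suc (Suc (d - 2))" using assms by auto
  have sy: "3 * (real (sylvester (d - 1)) - 1) = of_int (3 * int (sylv_prod (d - 2)))"
    unfolding d1(1) sylvester_Suc by simp
  have "{real (sylvester i) *\<^sub>R e i |i. i \<in> {1..d - 2}} =
      (\<lambda>i. real (sylvester (Suc i)) *\<^sub>R e (Suc i)) ` {..<d - 2}"
  proof -
    have "{1..d - 2} = Suc ` {..<d - 2}" by (simp add: image_Suc_lessThan)
    then show ?thesis by (auto simp: image_iff)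
  qed
  moreover have "{..d} = insert d (insert (d - 1) (insert (d - 2) {..<d - 2}))" using assms by auto
  ultimately have "(\<lambda>x. - c + x) ` S = corner e d ` {..d}"
    unfolding S_def sy using assms d1
    by (auto simp: corner_def side_def c_def image_Un image_image intro!: image_cong)
  moreover have "extremal_simplex d e = (\<lambda>x. - c + x) ` (convex hull S)"
    unfolding extremal_simplex_def S_def c_def by (intro image_cong) auto
  ultimately show ?thesis by (metis convex_hull_translation)
qed

section \<open>Counting cosets\<close>

lemma coset_eq_iff:
  fixes H :: "'a::ab_group_add set"
  assumes "0 \<in> H" "\<And>x y. x \<in> H \<Longrightarrow> y \<in> H \<Longrightarrow> x - y \<in> H"
  shows "(+) x ` H = (+) y ` H \<longleftrightarrow> x - y \<in> H"
proof
  assume "(+) x ` H = (+) y ` H"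
  then have "x + 0 \<in> (+) y ` H" using assms(1) by blast
  then show "x - y \<in> H" by auto
next
  have *: "(+) x ` H \<subseteq> (+) y ` H" if xy: "x - y \<in> H" for x y
  proof (rule image_subsetI)
    fix h assume "h \<in> H"
    moreover have "- h \<in> H" using assms(2)[OF assms(1) \<open>h \<in> H\<close>] by simp
    ultimately have "x - y + h \<in> H" using assms(2)[OF xy, of "- h"] by simp
    then show "x + h \<in> (+) y ` H" by (intro image_eqI[of _ _ "x - y + h"]) auto
  qed
  assume xy: "x - y \<in> H"
  then have "y - x \<in> H" using assms(2)[OF assms(1) xy] by simp
  with xy show "(+) x ` H = (+) y ` H" by (intro subset_antisym *)
qed

lemma subgroup_index_eq_card_image:
  fixes H :: "'a::ab_group_add set"
  assumes "0 \<in> H" "\<And>x y. x \<in> H \<Longrightarrow> y \<in> H \<Longrightarrow> x - y \<in> H"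
    and "\<And>x y. x \<in> N \<Longrightarrow> y \<in> N \<Longrightarrow> f x = f y \<longleftrightarrow> x - y \<in> H"
  shows "subgroup_index N H = card (f ` N)"
proof -
  obtain R where R: "R \<subseteq> N" "inj_on f R" "f ` N = f ` R"
    using subset_image_inj[of "f ` N" f N] by auto
  let ?g = "\<lambda>x. (+) x ` H"
  have iff: "?g x = ?g y \<longleftrightarrow> f x = f y" if "x \<in> N" "y \<in> N" for x y
    using coset_eq_iff[OF assms(1,2)] assms(3)[OF that] by simp
  have "?g ` N = ?g ` R"
  proof
    show "?g ` N \<subseteq> ?g ` R"
    proof (rule image_subsetI)
      fix x assume x: "x \<in> N"
      then obtain r where r: "r \<in> R" "f x = f r" using R(3) by blast
      then have "?g x = ?g r" using iff[OF x] R(1) by blast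
      with r(1) show "?g x \<in> ?g ` R" by blast
    qed
  qed (use R(1) in blast)
  moreover have "inj_on ?g R"
  proof (rule inj_onI)
    fix x y assume "x \<in> R" "y \<in> R" "?g x = ?g y"
    then show "x = y" using iff[of x y] R(1) by (intro inj_onD[OF R(2)]) auto
  qed
  ultimately show ?thesis
    unfolding subgroup_index_def using R by (simp add: card_image)
qed

text \<open>Finiteness is not assumed: \<open>R\<close> and the set of cosets are in bijection, and
  for infinite index both have \<open>card\<close> 0.\<close>

lemma subgroup_index_representatives:
  fixes H :: "'a::ab_group_add set"
  assumes "0 \<in> H" "\<And>x y. x \<in> H \<Longrightarrow> y \<in> H \<Longrightarrow> x - y \<in> H"
  obtains R where "R \<subseteq> N" "card R = subgroup_index N H"
    "\<And>x y. x \<in> R \<Longrightarrow> y \<in> R \<Longrightarrow> x - y \<in> H \<Longrightarrow> x = y"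
proof -
  let ?g = "\<lambda>x. (+) x ` H"
  obtain R where R: "R \<subseteq> N" "inj_on ?g R" "?g ` N = ?g ` R"
    using subset_image_inj[of "?g ` N" ?g N] by auto
  show ?thesis
  proof (rule that[OF R(1)])
    show "card R = subgroup_index N H"
      unfolding subgroup_index_def R(3) card_image[OF R(2)] ..
    fix x y assume "x \<in> R" "y \<in> R" "x - y \<in> H"
    then show "x = y" using coset_eq_iff[OF assms] by (intro inj_onD[OF R(2)]) simp_all
  qed
qed

text \<open>Eliminating \<open>k\<close> from \<open>H_iff\<close>: the two coordinates with modulus
  \<open>3 * u\<close> must agree modulo \<open>3 * u\<close>, and their value modulo
  \<open>u\<close> must match the Chinese remainder lift of the others. These two obstructions vary
  independently and take \<open>3 * u\<close> and \<open>u\<close> values.\<close>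

lemma extremal_index_count:
  fixes H :: "'a::ab_group_add set" and Y :: "nat \<Rightarrow> 'a \<Rightarrow> int"
  assumes d: "d \<ge> 2" and H: "0 \<in> H" "\<And>x y. x \<in> H \<Longrightarrow> y \<in> H \<Longrightarrow> x - y \<in> H"
    and N: "\<And>x y. x \<in> N \<Longrightarrow> y \<in> N \<Longrightarrow> x - y \<in> N"
    and Y_diff: "\<And>k x y. k < d \<Longrightarrow> x \<in> N \<Longrightarrow> y \<in> N \<Longrightarrow> Y k (x - y) = Y k x - Y k y"
    and Y_onto: "\<And>g. \<exists>x\<in>N. \<forall>k<d. Y k x = g k"
    and H_iff: "\<And>z. z \<in> N \<Longrightarrow> z \<in> H \<longleftrightarrow> (\<exists>k. \<forall>i<d. side d i dvd Y i z - k)"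
  shows "subgroup_index N H = 3 * sylv_prod (d - 2) ^ 2"
proof -
  define m where "m = d - 2"
  have dm: "d = Suc (Suc m)" using d by (simp add: m_def)
  then have md: "m < d" "Suc m < d" by auto
  define u where "u = int (sylv_prod m)"
  have u: "u > 0" by (simp add: u_def)
  obtain cr :: "nat \<Rightarrow> int" where cr: "\<And>i j. i < m \<Longrightarrow> j < m \<Longrightarrow>
      [cr i = (if i = j then 1 else 0)] (mod int (sylvester (Suc j)))"
    using sylvester_crt[of m] by metis
  define q where "q x = Y m x - (\<Sum>i<m. cr i * Y i x)" for x
  define f where "f x = ((Y (Suc m) x - Y m x) mod (3 * u), q x mod u)" for x
  have s_dvd_q: "int (sylvester (Suc j)) dvd q z - (Y m z - Y j z)" if "j < m" for j z
  proof -
    have "[(\<Sum>i<m. cr i * Y i z) = (\<Sum>i<m. (if i = j then 1 else 0) * Y i z)] (mod int (sylvester (Suc j)))"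
      by (intro cong_sum cong_mult cong_refl cr) (use that in auto)
    also have "(\<Sum>i<m. (if i = j then 1 else 0) * Y i z) = Y j z"
      using that by (simp add: if_distrib[of "\<lambda>c. c * _"] cong: if_cong)
    finally have "int (sylvester (Suc j)) dvd (\<Sum>i<m. cr i * Y i z) - Y j z"
      by (simp add: cong_iff_dvd_diff)
    moreover have "q z - (Y m z - Y j z) = - ((\<Sum>i<m. cr i * Y i z) - Y j z)" by (simp add: q_def)
    ultimately show ?thesis by (simp only: dvd_minus_iff)
  qed
  have s_dvd_u: "int (sylvester (Suc j)) dvd u" if "j < m" for j
    using sylvester_dvd_sylv_prod[OF that] unfolding u_def of_nat_dvd_iff .
  have side: "side d i = (if i < m then int (sylvester (Suc i)) else 3 * u)" for i
    by (simp add: side_def m_def u_def)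
  have criterion: "z \<in> H \<longleftrightarrow> 3 * u dvd Y (Suc m) z - Y m z \<and> u dvd q z" if z: "z \<in> N" for z
  proof
    assume "z \<in> H"
    then obtain k where k: "\<And>i. i < d \<Longrightarrow> side d i dvd Y i z - k" using H_iff[OF z] by auto
    have tail: "3 * u dvd Y m z - k" "3 * u dvd Y (Suc m) z - k"
      using k[of m] k[of "Suc m"] md by (simp_all add: side)
    have m3: "u dvd Y m z - k" using tail(1) by (rule dvd_mult_right)
    have "3 * u dvd (Y (Suc m) z - k) - (Y m z - k)" by (rule dvd_diff[OF tail(2,1)])
    moreover have "u dvd q z"
      unfolding u_def
    proof (rule sylv_prod_dvdI)
      fix j assume j: "j < m"
      have "int (sylvester (Suc j)) dvd Y j z - k" using k[of j] j md by (simp add: side)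
      moreover have "int (sylvester (Suc j)) dvd Y m z - k"
        using s_dvd_u[OF j] m3 by (rule dvd_trans)
      ultimately have "int (sylvester (Suc j)) dvd
          (q z - (Y m z - Y j z)) + ((Y m z - k) - (Y j z - k))"
        by (intro dvd_add[OF s_dvd_q[OF j]] dvd_diff[of _ "Y m z - k" "Y j z - k"])
      then show "int (sylvester (Suc j)) dvd q z" by simp
    qed
    ultimately show "3 * u dvd Y (Suc m) z - Y m z \<and> u dvd q z" by simp
  next
    assume a: "3 * u dvd Y (Suc m) z - Y m z \<and> u dvd q z"
    have "side d i dvd Y i z - Y m z" if "i < d" for i
    proof -
      consider "i < m" | "i = m" | "i = Suc m" using \<open>i < d\<close> dm by linarith
      then show ?thesis
      proof cases
        case 1
        have "int (sylvester (Suc i)) dvd (q z - (Y m z - Y i z)) - q z"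
          by (rule dvd_diff[OF s_dvd_q[OF 1] dvd_trans[OF s_dvd_u[OF 1]]]) (use a in simp)
        then show ?thesis using 1 by (simp add: side)
      qed (use a in \<open>simp_all add: side\<close>)
    qed
    then show "z \<in> H" using H_iff[OF z] by blast
  qed
  have q_diff: "q (x - y) = q x - q y" if "x \<in> N" "y \<in> N" for x y
    using Y_diff[OF _ that] dm by (simp add: q_def right_diff_distrib sum_subtractf)
  have "subgroup_index N H = card (f ` N)"
  proof (rule subgroup_index_eq_card_image[OF H])
    fix x y assume xy: "x \<in> N" "y \<in> N"
    have "f x = f y \<longleftrightarrow> 3 * u dvd Y (Suc m) (x - y) - Y m (x - y) \<and> u dvd q (x - y)"
      unfolding q_diff[OF xy] Y_diff[OF md(1) xy] Y_diff[OF md(2) xy] f_def prod.inject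
        mod_eq_dvd_iff by (simp add: algebra_simps)
    then show "f x = f y \<longleftrightarrow> x - y \<in> H" using criterion[OF N[OF xy]] by simp
  qed
  also have "f ` N = {0..<3 * u} \<times> {0..<u}"
  proof
    show "f ` N \<subseteq> {0..<3 * u} \<times> {0..<u}" using u by (auto simp: f_def)
    show "{0..<3 * u} \<times> {0..<u} \<subseteq> f ` N"
    proof clarify
      fix s t :: int assume s: "s \<in> {0..<3 * u}" and t: "t \<in> {0..<u}"
      obtain x where x: "x \<in> N" "\<And>k. k < d \<Longrightarrow> Y k x = (if k < m then 0 else if k = m then t else t + s)"
        \<comment> \<open>Zero head coordinates make the lift vanish, so that
          \<open>q x = t\<close>.\<close>
        using Y_onto[of "\<lambda>k. if k < m then 0 else if k = m then t else t + s"] by auto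
      have "f x = (s, t)" using s t x(2) dm by (simp add: f_def q_def)
      then show "(s, t) \<in> f ` N" using x(1) by (metis image_eqI)
    qed
  qed
  also have "card ({0..<3 * u} \<times> {0..<u}) = 3 * sylv_prod m ^ 2"
    by (simp add: card_cartesian_product u_def nat_mult_distrib power2_eq_square)
  finally show ?thesis by (simp add: m_def)
qed

section \<open>Integral coordinates of the simplex\<close>

locale rational_simplex = coordinatized_simplex e d N P v \<beta>
  for e :: "nat \<Rightarrow> 'a::euclidean_space" and d N P v \<beta> +
  fixes L :: "nat \<Rightarrow> 'a \<Rightarrow> real" and M :: int
  assumes L_linear: "linear (L i)" and L_sum: "(\<Sum>i\<le>d. L i x) = 0"
    and L_v_sum: "(\<Sum>i\<le>d. L i x *\<^sub>R v i) = x"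
    and L_unique: "sum c {..d} = 0 \<Longrightarrow> i \<le> d \<Longrightarrow> L i (\<Sum>i\<le>d. c i *\<^sub>R v i) = c i"
    and M_pos: "M > 0" and M_L: "x \<in> N \<Longrightarrow> i \<le> d \<Longrightarrow> of_int M * L i x \<in> \<int>"
begin

text \<open>The floor is exact on \<open>N\<close> for \<open>i \<le> d\<close>; the value 0 beyond
  \<open>d\<close> keeps \<open>l i\<close> additive for every \<open>i\<close>, as
  \<open>integral_simplex\<close> requires.\<close>

definition l :: "nat \<Rightarrow> 'a \<Rightarrow> int" where "l i x = (if i \<le> d then \<lfloor>of_int M * L i x\<rfloor> else 0)"

definition b :: "nat \<Rightarrow> int" where "b i = \<lfloor>of_int M * \<beta> i\<rfloor>"

lemma of_int_l: "x \<in> N \<Longrightarrow> i \<le> d \<Longrightarrow> of_int (l i x) = of_int M * L i x"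
  using M_L[of x i] by (simp add: l_def)

lemma L_v:
  assumes "i \<le> d" "j \<le> d"
  shows "L j (v i) = (if i = j then 1 else 0) - \<beta> j"
proof -
  define c where "c k = (if k = i then 1 else 0) - \<beta> k" for k
  have "sum c {..d} = 0" using assms \<beta>_sum by (simp add: c_def sum_subtractf)
  moreover have "(\<Sum>k\<le>d. c k *\<^sub>R v k) = v i"
  proof -
    have "(\<Sum>k\<le>d. c k *\<^sub>R v k) = (\<Sum>k\<le>d. if k = i then v k else 0) - (\<Sum>k\<le>d. \<beta> k *\<^sub>R v k)"
      by (simp add: c_def scaleR_left_diff_distrib sum_subtractf if_distrib[of "\<lambda>c. c *\<^sub>R _"] cong: if_cong)
    then show ?thesis using assms \<beta>_v by simp
  qed
  ultimately show ?thesis using L_unique[of c j] assms by (auto simp: c_def)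
qed

text \<open>As \<open>\<beta> j = 1 - L j (v j)\<close> with \<open>v j\<close> in \<open>N\<close>,
  a denominator for the coordinates of lattice points also clears those of the origin.\<close>

lemma of_int_b: "j \<le> d \<Longrightarrow> of_int (b j) = of_int M * \<beta> j"
proof -
  assume j: "j \<le> d"
  have "of_int M * \<beta> j = of_int M - of_int M * L j (v j)"
    using L_v[OF j j] by (simp add: right_diff_distrib)
  also have "\<dots> \<in> \<int>" using M_L[OF v_mem[OF j] j] by simp
  finally show ?thesis by (simp add: b_def)
qed

sublocale integral_simplex N d v b M l
proof
  fix x y i assume x: "x \<in> N" and y: "y \<in> N"
  then show "x - y \<in> N" by (rule N_diff)
  show "l i (x - y) = l i x - l i y"
  proof (cases "i \<le> d")
    case True
    then have "real_of_int (l i (x - y)) = real_of_int (l i x - l i y)"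
      using N_diff[OF x y] x y
      by (simp add: of_int_l linear_diff[OF L_linear] right_diff_distrib)
    then show ?thesis by linarith
  qed (simp add: l_def)
next
  fix x assume x: "x \<in> N"
  have "real_of_int (\<Sum>i\<le>d. l i x) = of_int M * (\<Sum>i\<le>d. L i x)"
    using of_int_l[OF x] by (simp add: sum_distrib_left)
  also have "\<dots> = 0" by (simp add: L_sum)
  finally show "(\<Sum>i\<le>d. l i x) = 0" by (simp only: of_int_eq_0_iff)
next
  fix i assume i: "i \<le> d"
  then show "v i \<in> N" by (rule v_mem)
  have "real_of_int (b i) > 0" using of_int_b[OF i] \<beta>_pos[OF i] M_pos by simp
  then show "0 < b i" by simp
  fix j assume j: "j \<le> d"
  have "real_of_int (l j (v i)) = real_of_int ((if i = j then M else 0) - b j)"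
    using of_int_l[OF v_mem[OF i] j] L_v[OF i j] of_int_b[OF j] by (simp add: right_diff_distrib)
  then show "l j (v i) = (if i = j then M else 0) - b j" by linarith
next
  have "real_of_int (sum b {..d}) = of_int M * sum \<beta> {..d}"
    using of_int_b by (simp add: sum_distrib_left)
  also have "\<dots> = of_int M" by (simp add: \<beta>_sum)
  finally show "sum b {..d} = M" by (simp only: of_int_eq_iff)
next
  fix x assume x: "x \<in> N" and low: "\<And>i. i \<le> d \<Longrightarrow> - b i < l i x"
  have "x \<in> interior P"
    unfolding P_eq interior_simplex_indexed[OF d_eq v_inj v_indep]
  proof (intro exI[of _ "\<lambda>i. L i x + \<beta> i"] conjI allI impI)
    fix i assume i: "i \<le> d"
    have "real_of_int (l i x + b i) > 0" using low[OF i] by linarith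
    then have "of_int M * (L i x + \<beta> i) > 0" using of_int_l[OF x i] of_int_b[OF i]
      by (simp add: distrib_left)
    then show "0 < L i x + \<beta> i" using M_pos by (simp add: zero_less_mult_iff)
  next
    show "(\<Sum>i\<le>d. L i x + \<beta> i) = 1" by (simp add: sum.distrib L_sum \<beta>_sum)
    show "(\<Sum>i\<le>d. (L i x + \<beta> i) *\<^sub>R v i) = x"
      by (simp add: scaleR_left_distrib sum.distrib L_v_sum \<beta>_v)
  qed
  then show "x = 0" using x interior by blast
qed

lemma range_comb: "range comb = int_span (v ` {..d})"
  unfolding int_span_image[OF v_inj finite_atMost] comb_def[abs_def] ..

lemma comb_diff: "x \<in> range comb \<Longrightarrow> y \<in> range comb \<Longrightarrow> x - y \<in> range comb"
proof safe
  fix a c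
  have "comb a - comb c = comb (\<lambda>i. a i - c i)"
    by (simp add: comb_def scaleR_left_diff_distrib sum_subtractf)
  then show "comb a - comb c \<in> range comb" by simp
qed

lemma comb_zero: "0 \<in> range comb"
  by (rule range_eqI[of _ _ "\<lambda>_. 0"]) (simp add: comb_def)

lemma of_int_prod_b: "n \<le> Suc d \<Longrightarrow> real_of_int (prod b {..<n}) = of_int M ^ n * prod \<beta> {..<n}"
  using of_int_b by (simp add: prod.distrib)

sublocale product_sum \<beta> d
proof
  fix j assume j: "0 < j" "j \<le> d"
  have "real_of_int (prod b {..<j}) \<le> real_of_int (M ^ (j - 1) * sum b {j..d})"
    using prod_le_sum_tail[OF j] by (simp only: of_int_le_iff)
  also have "real_of_int (M ^ (j - 1) * sum b {j..d}) = of_int M ^ (j - 1) * (of_int M * sum \<beta> {j..d})"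
    using of_int_b by (simp add: sum_distrib_left)
  also have "\<dots> = of_int M ^ j * sum \<beta> {j..d}" using j by (cases j) auto
  finally have "of_int M ^ j * prod \<beta> {..<j} \<le> of_int M ^ j * sum \<beta> {j..d}"
    using of_int_prod_b[of j] j by simp
  then show "prod \<beta> {..<j} \<le> sum \<beta> {j..d}" using M_pos by simp
qed (use \<beta>_pos \<beta>_anti \<beta>_sum in auto)

end

section \<open>The multiplicity bound and its equality case\<close>

context rational_simplex
begin

text \<open>\<open>K\<close> is \<open>M / b d\<close> rounded up: the largest number of shifts that
  \<open>inj_on_place\<close> allows, and enough for \<open>K * \<beta> d >= 1\<close>.\<close>

lemma multiplicity_packing:
  obtains R K where "R \<subseteq> N" "card R = simplex_mult N P" "(int K - 1) * b d < M" "M \<le> int K * b d"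
    "\<And>r r'. r \<in> R \<Longrightarrow> r' \<in> R \<Longrightarrow> r - r' \<in> range comb \<Longrightarrow> r = r'"
    "int K = (M + b d - 1) div b d"
proof -
  obtain R where R: "R \<subseteq> N" "card R = simplex_mult N P"
    "\<And>r r'. r \<in> R \<Longrightarrow> r' \<in> R \<Longrightarrow> r - r' \<in> range comb \<Longrightarrow> r = r'"
    using subgroup_index_representatives[OF comb_zero comb_diff, of N]
    unfolding simplex_mult_def vertices_P range_comb[symmetric] by metis
  define q where "q = (M + b d - 1) div b d"
  have bd: "b d > 0" by (rule b_pos) simp
  have "q * b d + (M + b d - 1) mod b d = M + b d - 1" by (simp add: q_def)
  moreover have "0 \<le> (M + b d - 1) mod b d" "(M + b d - 1) mod b d < b d" using bd by auto
  ultimately have q: "(q - 1) * b d < M" "M \<le> q * b d" by (auto simp: left_diff_distrib)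
  have "q * b d > 0" using q(2) M_pos by linarith
  then have "q > 0" using bd by (simp add: zero_less_mult_iff)
  then show ?thesis using that[of R "nat q"] R q by (simp add: q_def)
qed

lemma multiplicity_prod_le: "real (simplex_mult N P) * prod \<beta> {..<d - 1} \<le> 1"
proof -
  obtain R K where RK: "R \<subseteq> N" "card R = simplex_mult N P" "(int K - 1) * b d < M" "M \<le> int K * b d"
    "\<And>r r'. r \<in> R \<Longrightarrow> r' \<in> R \<Longrightarrow> r - r' \<in> range comb \<Longrightarrow> r = r'"
    using multiplicity_packing by metis
  have "real_of_int (int (card R * K) * prod b {..<d}) \<le> real_of_int (M ^ d)"
    using packing_bound[OF RK(1,3,5)] by (simp only: of_int_le_iff)
  then have "of_int M ^ d * (real (simplex_mult N P) * real K * prod \<beta> {..<d}) \<le> of_int M ^ d * 1"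
    using of_int_prod_b[of d] RK(2) by (simp add: mult_ac)
  then have packed: "real (simplex_mult N P) * real K * prod \<beta> {..<d} \<le> 1"
    using M_pos by (subst (asm) mult_le_cancel_left_pos) auto
  have "real_of_int M \<le> real_of_int (int K * b d)" using RK(4) by (simp only: of_int_le_iff)
  then have "of_int M * 1 \<le> of_int M * (real K * \<beta> d)" using of_int_b[of d] by (simp add: mult_ac)
  then have "1 \<le> real K * \<beta> d" using M_pos by (subst (asm) mult_le_cancel_left_pos) auto
  \<comment> \<open>Passing to \<open>\<beta> (d - 1)\<close> lets \<open>K\<close> cancel the last
    factor of the packed product.\<close>
  also have "\<dots> \<le> real K * \<beta> (d - 1)" using \<beta>_anti[of "d - 1" d] by (intro mult_left_mono) auto
  finally have K: "1 \<le> real K * \<beta> (d - 1)" .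
  have d: "d = Suc (d - 1)" using d_ge by simp
  have prod: "prod \<beta> {..<d} = prod \<beta> {..<d - 1} * \<beta> (d - 1)"
    by (subst d) (rule prod.lessThan_Suc)
  have nonneg: "0 \<le> real (simplex_mult N P) * prod \<beta> {..<d - 1}"
    using \<beta>_pos by (intro mult_nonneg_nonneg prod_nonneg) (auto intro: less_imp_le)
  have "real (simplex_mult N P) * prod \<beta> {..<d - 1} * 1 \<le>
      real (simplex_mult N P) * prod \<beta> {..<d - 1} * (real K * \<beta> (d - 1))"
    using K nonneg by (rule mult_left_mono)
  with packed show ?thesis unfolding prod by (simp add: mult_ac)
qed

text \<open>A large multiplicity pushes the product down to its minimum, so the coordinates are
  known. Evaluating the product at them bounds the multiplicity from above again, which also yields
  the inequality of the theorem.\<close>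

lemma multiplicity_extremal:
  assumes ge: "3 * sylv_prod (d - 2) ^ 2 \<le> simplex_mult N P"
  shows "i < d - 2 \<Longrightarrow> \<beta> i = 1 / real (sylvester (Suc i))"
    and "d - 2 \<le> i \<Longrightarrow> i \<le> d \<Longrightarrow> \<beta> i = 1 / (3 * real (sylv_prod (d - 2)))"
    and "simplex_mult N P = 3 * sylv_prod (d - 2) ^ 2"
proof -
  define u where "u = real (sylv_prod (d - 2))"
  have u: "u > 0" by (simp add: u_def)
  have prod_pos: "prod \<beta> {..<d - 1} > 0" using \<beta>_pos by (intro prod_pos) auto
  have "real (3 * sylv_prod (d - 2) ^ 2) \<le> real (simplex_mult N P)"
    using ge by (simp only: of_nat_le_iff)
  then have ge_real: "3 * u ^ 2 \<le> real (simplex_mult N P)" by (simp add: u_def)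
  then have "3 * u ^ 2 * prod \<beta> {..<d - 1} \<le> real (simplex_mult N P) * prod \<beta> {..<d - 1}"
    using prod_pos by (intro mult_right_mono) auto
  then have "prod \<beta> {..<d - 1} \<le> 1 / (3 * u ^ 2)"
    using multiplicity_prod_le u by (simp add: field_simps)
  note coords = extremal_coordinates[OF d_ge this[unfolded u_def]]
  show "i < d - 2 \<Longrightarrow> \<beta> i = 1 / real (sylvester (Suc i))" by (rule coords(1))
  show "d - 2 \<le> i \<Longrightarrow> i \<le> d \<Longrightarrow> \<beta> i = 1 / (3 * real (sylv_prod (d - 2)))"
    by (rule coords(2))
  have "{..<d - 1} = insert (d - 2) {..<d - 2}" using d_ge by auto
  then have "prod \<beta> {..<d - 1} = \<beta> (d - 2) * prod \<beta> {..<d - 2}" by simp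
  also have "prod \<beta> {..<d - 2} = 1 / u"
    unfolding u_def prod_inverse_sylvester[symmetric] by (intro prod.cong) (auto simp: coords(1))
  also have "\<beta> (d - 2) = 1 / (3 * u)" unfolding u_def by (rule coords(2)) auto
  finally have prod_eq: "prod \<beta> {..<d - 1} = 1 / (3 * u ^ 2)" by (simp add: power2_eq_square)
  have "real (simplex_mult N P) \<le> 3 * u ^ 2"
    using multiplicity_prod_le[unfolded prod_eq] u by (simp add: field_simps)
  with ge_real have "real (simplex_mult N P) = 3 * u ^ 2" by simp
  also have "\<dots> = real (3 * sylv_prod (d - 2) ^ 2)" by (simp add: u_def)
  finally show "simplex_mult N P = 3 * sylv_prod (d - 2) ^ 2" by (simp only: of_nat_eq_iff)
qed

text \<open>Now \<open>b d\<close> divides \<open>M\<close>, so the rounding in \<open>K\<close>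
  loses nothing and the packing estimate becomes an exact count of the torus.\<close>

lemma extremal_tiling:
  assumes ge: "3 * sylv_prod (d - 2) ^ 2 \<le> simplex_mult N P"
  shows "extremal_tiling N d v b M l (d - 2) (b d)"
proof -
  note coords = multiplicity_extremal[OF ge]
  define u where "u = int (sylv_prod (d - 2))"
  have u: "u > 0" by (simp add: u_def)
  have M_b: "M = b i * (3 * u)" if "d - 2 \<le> i" "i \<le> d" for i
  proof -
    have "real_of_int M = of_int M * (1 / (3 * of_int u)) * (3 * of_int u)" using u by simp
    also have "of_int M * (1 / (3 * of_int u)) = real_of_int (b i)"
      using of_int_b[OF that(2)] coords(2)[OF that] by (simp add: u_def)
    finally have "real_of_int M = real_of_int (b i * (3 * u))" by simp
    then show ?thesis by (simp only: of_int_eq_iff)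
  qed
  have M_head: "b i * int (sylvester (Suc i)) = M" if "i < d - 2" for i
  proof -
    have "real_of_int (b i * int (sylvester (Suc i))) = of_int M"
      using of_int_b[of i] coords(1)[OF that] that by (simp add: sylvester_Suc)
    then show ?thesis by (simp only: of_int_eq_iff)
  qed
  have M_tail: "b i = b d" if "d - 2 \<le> i" "i \<le> d" for i
  proof -
    have "b i * (3 * u) = b d * (3 * u)" using M_b[OF that] M_b[of d] by simp
    then show ?thesis using u by simp
  qed
  obtain R K where RK: "R \<subseteq> N" "card R = simplex_mult N P" "(int K - 1) * b d < M"
    "\<And>r r'. r \<in> R \<Longrightarrow> r' \<in> R \<Longrightarrow> r - r' \<in> range comb \<Longrightarrow> r = r'"
    "int K = (M + b d - 1) div b d"
    using multiplicity_packing by metis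
  have K: "int K = 3 * u"
  proof -
    have bd: "b d > 0" by (rule b_pos) simp
    have "(b d - 1 + (3 * u) * b d) div b d = 3 * u + (b d - 1) div b d"
      using bd by (subst div_mult_self1) auto
    also have "(b d - 1) div b d = 0" using bd by simp
    finally show ?thesis using RK(5) M_b[of d] by (simp add: algebra_simps)
  qed
  have prod_b: "u * (3 * u) ^ 2 * prod b {..<d} = M ^ d"
  proof -
    have "{..<d} = insert (d - 1) (insert (d - 2) {..<d - 2})" using d_ge by auto
    moreover have "d - 1 \<noteq> d - 2" using d_ge by simp
    ultimately have "prod b {..<d} = b (d - 1) * (b (d - 2) * prod b {..<d - 2})" by simp
    then have "u * (3 * u) ^ 2 * prod b {..<d} =
        (b (d - 1) * (3 * u)) * ((b (d - 2) * (3 * u)) * (prod b {..<d - 2} * u))"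
      by (simp add: power2_eq_square)
    also have "b (d - 1) * (3 * u) = M" using M_b[of "d - 1"] by simp
    also have "b (d - 2) * (3 * u) = M" using M_b[of "d - 2"] by simp
    also have "prod b {..<d - 2} * u = M ^ (d - 2)"
    proof -
      have "u = (\<Prod>i<d - 2. int (sylvester (Suc i)))" by (simp add: u_def sylv_prod_def)
      then have "prod b {..<d - 2} * u = (\<Prod>i<d - 2. b i * int (sylvester (Suc i)))"
        by (simp add: prod.distrib)
      then show ?thesis using M_head by simp
    qed
    also have "M * (M * M ^ (d - 2)) = M ^ Suc (Suc (d - 2))" by simp
    also have "Suc (Suc (d - 2)) = d" using d_ge by simp
    finally show ?thesis .
  qed
  have full: "int (card R * K) * prod b {..<d} = M ^ d"
  proof -
    have "int (card R * K) = u * (3 * u) ^ 2"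
      using RK(2) coords(3) K by (simp add: u_def power2_eq_square)
    then show ?thesis using prod_b by simp
  qed
  show ?thesis
  proof
    fix y :: "nat \<Rightarrow> int"
    show "\<exists>x\<in>N. \<forall>i<d. y i - b i < l i x \<and> l i x \<le> y i"
      using tiling[OF RK(1,3,4) full, of y] by blast
  next
    show "d = d - 2 + 2" using d_ge by simp
    show "M = 3 * int (sylv_prod (d - 2)) * b d" using M_b[of d] by (simp add: u_def ac_simps)
  qed (fact M_head M_tail)+
qed

text \<open>Since \<open>1 / \<beta> i = side d i\<close>, dividing each coordinate by
  \<open>\<beta> i\<close> sends vertices to corners. On \<open>N\<close> the quotients are
  \<open>l i x / b i\<close>, integral by \<open>b_dvd_l\<close> and arbitrary by
  \<open>coordinates_onto\<close>, so the map is an automorphism of \<open>N\<close>.\<close>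

lemma extremal_equiv:
  assumes ge: "3 * sylv_prod (d - 2) ^ 2 \<le> simplex_mult N P"
  shows "unimodular_equiv N P (extremal_simplex d e)"
proof -
  interpret T: extremal_tiling N d v b M l "d - 2" "b d"
    by (rule extremal_tiling[OF ge])
  note coords = multiplicity_extremal[OF ge]
  have side: "of_int (side d i) * \<beta> i = 1" if "i \<le> d" for i
    using coords(1)[of i] coords(2)[of i] that sylv_prod_pos[of "d - 2"]
    by (cases "i < d - 2") (simp_all add: side_def sylvester_Suc)
  have \<beta>_nz: "\<beta> i \<noteq> 0" if "i \<le> d" for i using \<beta>_pos[OF that] by simp
  define A where "A x = (\<Sum>i<d. (L i x / \<beta> i) *\<^sub>R e (Suc i))" for x
  have A_lin: "linear A"
    unfolding A_def
    by (intro linearI) (simp_all add: linear_add[OF L_linear] linear_cmul[OF L_linear]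
        add_divide_distrib scaleR_left_distrib sum.distrib scaleR_sum_right)
  have ratio: "L i x / \<beta> i = of_int (l i x div b i)" if "x \<in> N" "i < d" for x i
  proof -
    have "real_of_int (l i x div b i) = real_of_int (l i x) / real_of_int (b i)"
      using T.b_dvd_l[OF that(1), of i] that(2) by (simp add: real_of_int_div)
    also have "\<dots> = L i x / \<beta> i"
      using of_int_l[OF that(1), of i] of_int_b[of i] that(2) M_pos by simp
    finally show ?thesis by simp
  qed
  have A_mem: "A x \<in> N" if "x \<in> N" for x
    unfolding N_mem_iff A_def sum_atLeast1_shift using ratio[OF that]
    by (intro exI[of _ "\<lambda>k. l (k - 1) x div b (k - 1)"] sum.cong) auto
  have e_span_unique: "\<forall>i<d. a i = c i" if eq: "(\<Sum>i<d. a i *\<^sub>R e (Suc i)) = (\<Sum>i<d. c i *\<^sub>R e (Suc i))" for a c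
  proof -
    obtain X where X: "\<And>i. linear (X i)" "\<And>x. (\<Sum>i\<in>{1..d}. X i x *\<^sub>R e i) = x"
      "\<And>i c. i \<in> {1..d} \<Longrightarrow> X i (\<Sum>j\<in>{1..d}. c j *\<^sub>R e j) = (c i :: real)"
      using basis_coordinates[of "{1..d}" e] e_inj e_indep d_eq by auto
    have "X (Suc i) (\<Sum>i<d. c i *\<^sub>R e (Suc i)) = c i" if "i < d" for c i
      using X(3)[of "Suc i" "\<lambda>j. c (j - 1)", unfolded sum_atLeast1_shift] that by simp
    then show ?thesis using eq by metis
  qed
  have "bij_betw A N N"
    unfolding bij_betw_def
  proof
    show "inj_on A N"
    proof (rule inj_onI)
      fix x y assume x: "x \<in> N" and y: "y \<in> N" and eq: "A x = A y"
      have ratio_eq: "L i x / \<beta> i = L i y / \<beta> i" if "i < d" for i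
        using e_span_unique[OF eq[unfolded A_def]] that by blast
      have "L i x = L i y" if "i < d" for i using ratio_eq[OF that] that \<beta>_nz[of i] by simp
      then have "l i x = l i y" if "i < d" for i using that by (simp add: l_def)
      then have "l i (x - y) = 0" if "i < d" for i using that l_diff[OF x y] by simp
      then have "x - y = 0"
        using canonical_symmetric[OF N_diff[OF x y]] b_pos by simp
      then show "x = y" by simp
    qed
    show "A ` N = N"
    proof
      show "N \<subseteq> A ` N"
      proof
        fix y assume "y \<in> N"
        then obtain c where c: "y = (\<Sum>j\<in>{1..d}. of_int (c j) *\<^sub>R e j)" unfolding N_mem_iff by auto
        obtain x where x: "x \<in> N" "\<And>i. i < d \<Longrightarrow> l i x = c (Suc i) * b i"
          using T.coordinates_onto[of "\<lambda>i. c (Suc i)"] by auto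
        have "l i x div b i = c (Suc i)" if "i < d" for i
          using x(2)[OF that] b_pos[of i] that by simp
        then have "A x = y"
          unfolding c sum_atLeast1_shift A_def using ratio[OF x(1)] by (intro sum.cong) auto
        then show "y \<in> A ` N" using x(1) by blast
      qed
    qed (use A_mem in blast)
  qed
  have A_v: "A (v j) = corner e d j" if "j \<le> d" for j
  proof -
    have "A (v j) = (\<Sum>i<d. ((if j = i then of_int (side d i) else 0) - 1) *\<^sub>R e (Suc i))"
      unfolding A_def
    proof (intro sum.cong refl arg_cong2[where f = scaleR])
      fix i assume "i \<in> {..<d}"
      then have i: "i \<le> d" by simp
      have "1 / \<beta> i = of_int (side d i)" using side[OF i] \<beta>_nz[OF i] by (simp add: field_simps)
      then show "L i (v j) / \<beta> i = (if j = i then of_int (side d i) else 0) - 1"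
        using L_v[OF that i] \<beta>_nz[OF i] by (simp add: diff_divide_distrib)
    qed
    also have "\<dots> = (\<Sum>i<d. if j = i then of_int (side d i) *\<^sub>R e (Suc i) else 0) - (\<Sum>i<d. e (Suc i))"
      by (simp add: scaleR_left_diff_distrib sum_subtractf if_distrib[of "\<lambda>c. c *\<^sub>R _"] cong: if_cong)
    also have "\<dots> = corner e d j" unfolding corner_def sum_atLeast1_shift by simp
    finally show ?thesis .
  qed
  have "A ` P = convex hull (corner e d ` {..d})"
  proof -
    have "A ` v ` {..d} = corner e d ` {..d}"
      unfolding image_image by (intro image_cong refl A_v) simp
    then show ?thesis unfolding P_eq convex_hull_linear_image[OF A_lin] by simp
  qed
  then have "extremal_simplex d e = (\<lambda>x. A x + 0) ` P"
    using extremal_simplex_eq[of d e] d_ge by simp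
  then show ?thesis
    unfolding unimodular_equiv_def using A_lin \<open>bij_betw A N N\<close> zero_mem by blast
qed

end

context coordinatized_simplex
begin

lemma rational_coordinates:
  obtains L M where "rational_simplex e d N P v \<beta> L M"
proof (rule difference_coordinates)
  fix L :: "nat \<Rightarrow> 'a \<Rightarrow> real"
  assume L: "\<And>i. linear (L i)" "\<And>x. (\<Sum>i\<le>d. L i x) = 0" "\<And>x. (\<Sum>i\<le>d. L i x *\<^sub>R v i) = x"
    "\<And>c i. sum c {..d} = 0 \<Longrightarrow> i \<le> d \<Longrightarrow> L i (\<Sum>i\<le>d. c i *\<^sub>R v i) = c i"
  show thesis
  proof (rule common_denominator[OF L])
    fix M :: int
    assume M: "M > 0" "\<And>x i. x \<in> N \<Longrightarrow> i \<le> d \<Longrightarrow> of_int M * L i x \<in> \<int>"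
    have "rational_simplex e d N P v \<beta> L M"
      by (intro rational_simplex.intro rational_simplex_axioms.intro coordinatized_simplex_axioms)
        (fact L M)+
    then show thesis by (rule that)
  qed
qed

text \<open>Once the translation is known to vanish, \<open>A\<close> carries the vertex lattice to
  the one generated by the corners, where \<open>extremal_index_count\<close> applies.\<close>

lemma equiv_multiplicity:
  assumes "unimodular_equiv N P (extremal_simplex d e)"
  shows "simplex_mult N P = 3 * sylv_prod (d - 2) ^ 2"
proof -
  obtain A w where A: "linear A" "bij_betw A N N" "w \<in> N"
    and ext: "extremal_simplex d e = (\<lambda>x. A x + w) ` P"
    using assms unfolding unimodular_equiv_def by auto
  obtain X where X: "\<And>i. linear (X i)" "\<And>x. (\<Sum>i\<in>{1..d}. X i x *\<^sub>R e i) = x"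
    "\<And>i c. i \<in> {1..d} \<Longrightarrow> X i (\<Sum>j\<in>{1..d}. c j *\<^sub>R e j) = (c i :: real)"
    using basis_coordinates[of "{1..d}" e] e_inj e_indep d_eq by auto
  have A_N: "A ` N = N" using A(2) by (simp add: bij_betw_def)
  have "surj A"
  proof -
    have "\<forall>i\<in>{1..d}. \<exists>f. A f = e i" using e_mem A_N by (metis imageE)
    then obtain f where f: "\<And>i. i \<in> {1..d} \<Longrightarrow> A (f i) = e i" by metis
    have "A (\<Sum>i\<in>{1..d}. X i x *\<^sub>R f i) = x" for x
      using X(2)[of x] f by (simp add: linear_sum[OF A(1)] linear_cmul[OF A(1)])
    then show ?thesis by (rule surjI)
  qed
  then obtain B where B: "linear B" "\<And>x. B (A x) = x" "\<And>x. A (B x) = x"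
    using linear_surjective_isomorphism[OF A(1)] by blast
  have B_N: "B x \<in> N" if "x \<in> N" for x using that A_N B(2) by (metis imageE)
  define v' where "v' i = B (corner e d i - w)" for i
  have T_v': "A (v' i) + w = corner e d i" for i by (simp add: v'_def B(3))
  have P': "P = convex hull (v' ` {..d})"
  proof -
    have T: "(\<lambda>x. A x + w) ` S = (\<lambda>x. w + x) ` A ` S" for S by (auto simp: image_image add.commute)
    have "(\<lambda>x. A x + w) ` (convex hull (v' ` {..d})) = convex hull ((\<lambda>x. A x + w) ` (v' ` {..d}))"
      unfolding T convex_hull_linear_image[OF A(1)] convex_hull_translation ..
    also have "(\<lambda>x. A x + w) ` (v' ` {..d}) = corner e d ` {..d}"
      by (simp add: image_image T_v')
    also have "convex hull (corner e d ` {..d}) = (\<lambda>x. A x + w) ` P"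
      using ext extremal_simplex_eq[of d e] d_ge by simp
    finally have "(\<lambda>x. A x + w) ` (convex hull (v' ` {..d})) = (\<lambda>x. A x + w) ` P" .
    moreover have "inj (\<lambda>x. A x + w)" by (rule injI) (metis B(2) add_right_cancel)
    ultimately show ?thesis by (metis inj_image_eq_iff)
  qed
  \<comment> \<open>The \<open>v' i\<close> are at most \<open>d + 1\<close> points containing all
    \<open>d + 1\<close> vertices, so they enumerate the vertices without repetition.\<close>
  have sub: "v ` {..d} \<subseteq> v' ` {..d}"
    using extreme_points_of_convex_hull[of "v' ` {..d}"] vertices_P
    unfolding P'[symmetric] vertices_def by simp
  have card_v: "card (v ` {..d}) = Suc d" using v_inj by (simp add: card_image)
  have card_v': "card (v' ` {..d}) = Suc d"
    using card_mono[OF _ sub] card_v card_image_le[of "{..d}" v'] by simp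
  have v'_eq: "v' ` {..d} = v ` {..d}"
    using card_subset_eq[OF _ sub] card_v card_v' by simp
  have v'_inj: "inj_on v' {..d}" using card_v' by (intro eq_card_imp_inj_on) auto
  have corner_sum: "(\<Sum>i\<le>d. g i *\<^sub>R corner e d i) =
      (\<Sum>i<d. (g i * of_int (side d i) - sum g {..d}) *\<^sub>R e (Suc i))" for g
  proof -
    have "(\<Sum>i\<le>d. g i *\<^sub>R corner e d i) =
        (\<Sum>i\<le>d. g i *\<^sub>R (if i < d then of_int (side d i) *\<^sub>R e (Suc i) else 0)) -
        sum g {..d} *\<^sub>R (\<Sum>i<d. e (Suc i))"
      unfolding corner_def sum_atLeast1_shift
      by (simp add: scaleR_right_diff_distrib sum_subtractf scaleR_sum_left)
    also have "(\<Sum>i\<le>d. g i *\<^sub>R (if i < d then of_int (side d i) *\<^sub>R e (Suc i) else 0)) =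
        (\<Sum>i<d. (g i * of_int (side d i)) *\<^sub>R e (Suc i))"
      unfolding sum_atMost_last by simp
    finally show ?thesis by (simp add: scaleR_left_diff_distrib sum_subtractf scaleR_sum_right)
  qed
  \<comment> \<open>These are the weights of the origin in the extremal simplex. The point
    \<open>p\<close> of \<open>P\<close> with the same weights is an interior lattice point mapped
    to the origin, so \<open>p = 0\<close> and \<open>w = 0\<close>.\<close>
  define \<gamma> where "\<gamma> i = 1 / real_of_int (side d i)" for i
  have \<gamma>_pos: "\<gamma> i > 0" for i using side_pos[of d i] by (simp add: \<gamma>_def)
  have \<gamma>_sum: "sum \<gamma> {..d} = 1"
  proof -
    have "{..d} = insert d (insert (d - 1) (insert (d - 2) {..<d - 2}))" using d_ge by auto
    moreover have "d - 1 \<noteq> d - 2" "d - 1 \<noteq> d" "d - 2 \<noteq> d" using d_ge by auto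
    ultimately have "sum \<gamma> {..d} = \<gamma> d + (\<gamma> (d - 1) + (\<gamma> (d - 2) + sum \<gamma> {..<d - 2}))"
      by simp
    moreover have "sum \<gamma> {..<d - 2} = 1 - 1 / real (sylv_prod (d - 2))"
      unfolding sum_inverse_sylvester[symmetric]
      by (intro sum.cong) (auto simp: \<gamma>_def side_def)
    moreover have tail: "\<gamma> i = 1 / (3 * real (sylv_prod (d - 2)))" if "d - 2 \<le> i" for i
      using that by (simp add: \<gamma>_def side_def)
    have "\<gamma> d = 1 / (3 * real (sylv_prod (d - 2)))"
      "\<gamma> (d - 1) = 1 / (3 * real (sylv_prod (d - 2)))"
      "\<gamma> (d - 2) = 1 / (3 * real (sylv_prod (d - 2)))" by (rule tail, simp)+
    ultimately show ?thesis by simp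
  qed
  define p where "p = (\<Sum>i\<le>d. \<gamma> i *\<^sub>R v' i)"
  have "A p + w = (\<Sum>i\<le>d. \<gamma> i *\<^sub>R (A (v' i) + w))"
    by (simp add: p_def linear_sum[OF A(1)] linear_cmul[OF A(1)] scaleR_right_distrib
        sum.distrib scaleR_sum_left[symmetric] \<gamma>_sum)
  also have "\<dots> = 0"
    unfolding T_v' corner_sum \<gamma>_sum using side_pos[of d] by (simp add: \<gamma>_def less_imp_neq[symmetric])
  finally have Ap: "A p + w = 0" .
  have "p \<in> interior P"
    unfolding P' using interior_simplex_indexed[OF d_eq v'_inj, of p] v_indep \<gamma>_pos \<gamma>_sum
    by (auto simp: v'_eq p_def)
  moreover have "p \<in> N"
  proof -
    have "p = B (- w)" using Ap B(2)[of p] by (simp add: eq_neg_iff_add_eq_0[symmetric])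
    moreover have "- w \<in> N" using N_scale[OF A(3), of "- 1"] by simp
    ultimately show ?thesis by (simp add: B_N)
  qed
  ultimately have "p = 0" using interior by blast
  then have "w = 0" using Ap linear_0[OF A(1)] by simp
  then have A_v': "A (v' i) = corner e d i" for i using T_v'[of i] by simp
  define Y where "Y i x = \<lfloor>X (Suc i) (A x)\<rfloor>" for i x
  have AN: "A x \<in> N" if "x \<in> N" for x using that A_N by blast
  have Y_of: "of_int (Y i x) = X (Suc i) (A x)" if x: "x \<in> N" and i: "i < d" for x i
  proof -
    obtain c where "A x = (\<Sum>j\<in>{1..d}. of_int (c j) *\<^sub>R e j)"
      using AN[OF x] unfolding N_mem_iff by auto
    then have "X (Suc i) (A x) = of_int (c (Suc i))" using X(3)[of "Suc i"] i by simp
    then show ?thesis by (simp add: Y_def)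
  qed
  have A_expand: "A x = (\<Sum>i<d. of_int (Y i x) *\<^sub>R e (Suc i))" if "x \<in> N" for x
    using X(2)[of "A x"] Y_of[OF that] unfolding sum_atLeast1_shift by simp
  have Y_unique: "Y i x = c i" if "i < d" "A x = (\<Sum>i<d. of_int (c i) *\<^sub>R e (Suc i))" for i x c
    using X(3)[of "Suc i" "\<lambda>j. of_int (c (j - 1))", unfolded sum_atLeast1_shift] that by (simp add: Y_def)
  define H where "H = int_span (v ` {..d})"
  have H_eq: "H = range (\<lambda>c. \<Sum>i\<le>d. of_int (c i) *\<^sub>R v' i)"
    unfolding H_def v'_eq[symmetric] by (rule int_span_image[OF v'_inj]) simp
  have "subgroup_index N H = 3 * sylv_prod (d - 2) ^ 2"
  proof (rule extremal_index_count[of d H N Y])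
    show "0 \<in> H" unfolding H_eq by (rule range_eqI[of _ _ "\<lambda>_. 0"]) simp
    show "x - y \<in> H" if xy: "x \<in> H" "y \<in> H" for x y
    proof -
      obtain a c where "x = (\<Sum>i\<le>d. of_int (a i) *\<^sub>R v' i)" "y = (\<Sum>i\<le>d. of_int (c i) *\<^sub>R v' i)"
        using xy unfolding H_eq by auto
      then have "x - y = (\<Sum>i\<le>d. of_int (a i - c i) *\<^sub>R v' i)"
        by (simp add: scaleR_left_diff_distrib sum_subtractf)
      then show ?thesis unfolding H_eq by (rule range_eqI[of _ _ "\<lambda>i. a i - c i"])
    qed
    show "Y k (x - y) = Y k x - Y k y" if "k < d" "x \<in> N" "y \<in> N" for k x y
    proof (rule Y_unique[OF that(1)])
      show "A (x - y) = (\<Sum>i<d. of_int (Y i x - Y i y) *\<^sub>R e (Suc i))"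
        using A_expand that by (simp add: linear_diff[OF A(1)] scaleR_left_diff_distrib sum_subtractf)
    qed
    show "\<exists>x\<in>N. \<forall>k<d. Y k x = g k" for g
    proof (intro bexI allI impI)
      have "(\<Sum>j\<in>{1..d}. of_int (g (j - 1)) *\<^sub>R e j) \<in> N"
        unfolding N_mem_iff by (rule exI[of _ "\<lambda>j. g (j - 1)"]) (rule refl)
      then show "B (\<Sum>i<d. of_int (g i) *\<^sub>R e (Suc i)) \<in> N" unfolding sum_atLeast1_shift by (simp add: B_N)
      show "Y k (B (\<Sum>i<d. of_int (g i) *\<^sub>R e (Suc i))) = g k" if "k < d" for k
        by (rule Y_unique[OF that]) (simp add: B(3))
    qed
    show "z \<in> H \<longleftrightarrow> (\<exists>k. \<forall>i<d. side d i dvd Y i z - k)" if z: "z \<in> N" for z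
    proof
      assume "z \<in> H"
      then obtain c where c: "z = (\<Sum>i\<le>d. of_int (c i) *\<^sub>R v' i)" unfolding H_eq by auto
      have "A z = (\<Sum>i\<le>d. of_int (c i) *\<^sub>R corner e d i)"
        unfolding c by (simp add: linear_sum[OF A(1)] linear_cmul[OF A(1)] A_v')
      also have "\<dots> = (\<Sum>i<d. of_int (c i * side d i - sum c {..d}) *\<^sub>R e (Suc i))"
        unfolding corner_sum by simp
      finally have Az: "A z = (\<Sum>i<d. of_int (c i * side d i - sum c {..d}) *\<^sub>R e (Suc i))" .
      have "Y i z = c i * side d i - sum c {..d}" if "i < d" for i
        by (rule Y_unique[OF that Az])
      then have "\<forall>i<d. side d i dvd Y i z - (- sum c {..d})" by simp
      then show "\<exists>k. \<forall>i<d. side d i dvd Y i z - k" by blast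
    next
      assume "\<exists>k. \<forall>i<d. side d i dvd Y i z - k"
      then obtain k where k: "\<And>i. i < d \<Longrightarrow> side d i dvd Y i z - k" by auto
      \<comment> \<open>The coefficient at \<open>d\<close>, whose corner has no axis, makes the sum
        \<open>- k\<close>.\<close>
      define c where "c i = (if i < d then (Y i z - k) div side d i
          else - k - (\<Sum>i<d. (Y i z - k) div side d i))" for i
      have c_sum: "sum c {..d} = - k" unfolding sum_atMost_last by (simp add: c_def)
      have "A (\<Sum>i\<le>d. of_int (c i) *\<^sub>R v' i) = (\<Sum>i\<le>d. of_int (c i) *\<^sub>R corner e d i)"
        by (simp add: linear_sum[OF A(1)] linear_cmul[OF A(1)] A_v')
      also have "\<dots> = (\<Sum>i<d. of_int (c i * side d i - sum c {..d}) *\<^sub>R e (Suc i))"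
        unfolding corner_sum by simp
      also have "\<dots> = A z"
        unfolding A_expand[OF z] c_sum using k by (intro sum.cong) (auto simp: c_def)
      finally have "z = (\<Sum>i\<le>d. of_int (c i) *\<^sub>R v' i)" by (metis B(2))
      then show "z \<in> H" unfolding H_eq by (rule range_eqI[of _ _ c])
    qed
  qed (use d_ge N_diff in auto)
  then show ?thesis unfolding simplex_mult_def vertices_P H_def .
qed

end

theorem theorem2p9:
  fixes e :: "nat \<Rightarrow> 'a::euclidean_space" and d :: nat and N P :: "'a set"
  assumes "d = DIM('a)" and "d \<ge> 5"
    and "inj_on e {1..d}" and "independent (e ` {1..d})"
    and "N = int_span (e ` {1..d})"
    and "canonical_lattice_simplex N P"
  shows "int (simplex_mult N P) \<le> 3 * (int (sylvester (d - 1)) - 1)\<^sup>2 \<and>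
    (int (simplex_mult N P) = 3 * (int (sylvester (d - 1)) - 1)\<^sup>2 \<longleftrightarrow>
       unimodular_equiv N P (extremal_simplex d e))"
proof -
  obtain v \<beta> where "coordinatized_simplex e d N P v \<beta>"
    using canonical_coordinatized[OF assms] by blast
  then interpret coordinatized_simplex e d N P v \<beta> .
  obtain L M where "rational_simplex e d N P v \<beta> L M"
    using rational_coordinates by blast
  then interpret rational_simplex e d N P v \<beta> L M .
  have "d - 1 = Suc (d - 2)" using d_ge by simp
  then have bound: "3 * (int (sylvester (d - 1)) - 1)\<^sup>2 = int (3 * sylv_prod (d - 2) ^ 2)"
    by (simp add: sylvester_Suc)
  \<comment> \<open>A multiplicity reaching the bound equals it, so the bound is never
    exceeded.\<close>
  have le: "simplex_mult N P \<le> 3 * sylv_prod (d - 2) ^ 2"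
    using multiplicity_extremal(3) by (cases "3 * sylv_prod (d - 2) ^ 2 \<le> simplex_mult N P") auto
  show ?thesis
    unfolding bound of_nat_le_iff of_nat_eq_iff
    using le extremal_equiv equiv_multiplicity by auto
qed

end
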